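(* Let $(E,\rho,[\cdot,\cdot]_E,L)$ be a regular local pre-Leibniz algebroid with a locality projector $\mathcal{P}$, and let $\nabla$ be an admissible linear $E$-connection. Then, on any local $E$-frame $(X_a)$ with dual coframe $(e^a)$, the following Cartan structure equations hold: $$T^a(\nabla)=d(\nabla)e^a+\omega^a{}_b(\nabla)\wedge e^b,$$ $$R^a{}_b(\nabla)=\hat d(\nabla)\omega^a{}_b(\nabla)+\omega^a{}_c(\nabla)\wedge\omega^c{}_b(\nabla).$$
   Context: Everything is smooth. $M$ is a manifold, $E\to M$ a real vector bundle of constant rank, $\mathfrak{X}(E)=\Gamma(E)$, $\Omega^p(E)=\Gamma(\Lambda^pE^* )$. An anchored vector bundle $(E,\rho)$ has a vector bundle morphism $\rho:E\to T(M)$ over the identity; it is regular if $\ker\rho$ has locally constant rank. A pre-Leibniz algebroid $(E,\rho,[\cdot,\cdot]_E)$ is an anchored vector bundle with an $\mathbb{R}$-bilinear bracket on $\mathfrak{X}(E)$ satisfying $[u,fv]_E=\rho(u)(f)v+f[u,v]_E$ and $\rho([u,v]_E)=[\rho(u),\rho(v)]$. It is local with locality operator $L$, a $C^\infty(M,\mathbb{R})$-multilinear map $L:\Omega^1(E)\times\mathfrak{X}(E)\times\mathfrak{X}(E)\to\mathfrak{X}(E)$, if $[fu,v]_E=-\rho(v)(f)u+f[u,v]_E+L(Df,u,v)$, where $(Df)(u):=\rho(u)(f)$. A locality projector is a $C^\infty(M,\mathbb{R})$-linear map $\mathcal{P}:\mathfrak{X}(E)\to\mathfrak{X}(E)$ such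 that the image of $\hat L:=\mathcal{P}L$ lies in $\ker\rho$ and $\mathcal{P}$ restricts to the identity on $\ker\rho$. A linear $E$-connection is an $\mathbb{R}$-bilinear map $\nabla:\mathfrak{X}(E)\times\mathfrak{X}(E)\to\mathfrak{X}(E)$ with $\nabla_u(fv)=\rho(u)(f)v+f\nabla_uv$ and $\nabla_{fu}v=f\nabla_uv$. Repeated indices are summed; $L(e^a,\nabla_{X_a}u,v)$ does not depend on the frame. $\nabla$ is admissible if $[u,v]_E+[v,u]_E=L(e^a,\nabla_{X_a}u,v)+L(e^a,\nabla_{X_a}v,u)$ for all $u,v$. Modified bracket: $[u,v]_E^\nabla:=[u,v]_E-L(e^a,\nabla_{X_a}u,v)$. Projected modified bracket: $[u,v]_E^{\hat\nabla}:=[u,v]_E-\hat L(e^a,\nabla_{X_a}u,v)$. For admissible $\nabla$ both are anti-symmetric. $E$-torsion and $E$-curvature: $T(\nabla)(u,v):=\nabla_uv-\nabla_vu-[u,v]_E^\nabla$, $R(\nabla)(u,v)w:=\nabla_u\nabla_vw-\nabla_v\nabla_uw-\nabla_{[u,v]_E^{\hat\nabla}}w$. The forms: $T^a(\nabla)(u,v):=\langle e^a,T(\nabla)(u,v)\rangle$, $R^a{}_b(\nabla)(u,v):=\langle e^a,R(\nabla)(u,v)X_b\rangle$, $\omega^a{}_b(\nabla)(v):=\langle e^a,\nabla_vX_b\rangle$. The $E$-exterior derivative $d(\nabla):\Omega^p(E)\to\Omega^{p+1}(E)$ is $$d(\nabla)\Omega(v_1,\dots,v_{p+1}):=\sum_i(-1)^{i+1}\rho(v_i)\big(\Omega(v_1,\dots,\check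 v_i,\dots,v_{p+1})\big)+\sum_{i<j}(-1)^{i+j}\Omega([v_i,v_j]_E^\nabla,v_1,\dots,\check v_i,\dots,\check v_j,\dots,v_{p+1}),$$ where $\check v_i$ means omitted; the projected $E$-exterior derivative $\hat d(\nabla)$ is given by the same formula with $[\cdot,\cdot]_E^{\hat\nabla}$ in place of $[\cdot,\cdot]_E^\nabla$. Convention: $(\alpha\wedge\beta)(u,v)=\alpha(u)\beta(v)-\alpha(v)\beta(u)$ for 1-forms. *)

theory Defs
  imports "HOL-Analysis.Analysis"
begin

section \<open>Smooth manifolds\<close>

primrec Ck_on :: "nat \<Rightarrow> 'a::real_normed_vector set \<Rightarrow> ('a \<Rightarrow> 'c::real_normed_vector) \<Rightarrow> bool" where
  "Ck_on 0 S f \<longleftrightarrow> continuous_on S f"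
| "Ck_on (Suc k) S f \<longleftrightarrow>
     (\<forall>x\<in>S. f differentiable (at x)) \<and> (\<forall>w. Ck_on k S (\<lambda>x. frechet_derivative f (at x) w))"

text \<open>Smoothness; only meant for open \<open>S\<close>.\<close>

definition Cinf_on :: "'a::real_normed_vector set \<Rightarrow> ('a \<Rightarrow> 'c::real_normed_vector) \<Rightarrow> bool" where
  "Cinf_on S f \<longleftrightarrow> (\<forall>k. Ck_on k S f)"

text \<open>The manifold is a whole (Hausdorff, second countable) type \<open>'m\<close>. The model space \<open>'b\<close> is a
  finite-dimensional real inner product space; unlike class \<open>euclidean_space\<close> this
  admits dimension 0. A chart is given by its domain and its coordinate map.\<close>

type_synonym ('m, 'b) chart = "'m set \<times> ('m \<Rightarrow> 'b)"

definition smooth_manifold ::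
  "('m::{t2_space,second_countable_topology}, 'b::real_inner) chart set \<Rightarrow> bool" where
  "smooth_manifold A \<longleftrightarrow>
     (\<exists>B::'b set. finite B \<and> span B = UNIV) \<and>
     (\<Union>(U,\<phi>)\<in>A. U) = UNIV \<and>
     (\<forall>(U,\<phi>)\<in>A. open U \<and> open (\<phi> ` U) \<and> homeomorphism U (\<phi> ` U) \<phi> (inv_into U \<phi>)) \<and>
     (\<forall>(U,\<phi>)\<in>A. \<forall>(V,\<psi>)\<in>A. Cinf_on (\<phi> ` (U \<inter> V)) (\<psi> \<circ> inv_into U \<phi>))"

definition smooth_fun ::
  "('m::{t2_space,second_countable_topology}, 'b::real_inner) chart set \<Rightarrow>
   'm set \<Rightarrow> ('m \<Rightarrow> 'c::real_normed_vector) \<Rightarrow> bool" where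
  "smooth_fun A U f \<longleftrightarrow> (\<forall>(V,\<phi>)\<in>A. Cinf_on (\<phi> ` (U \<inter> V)) (f \<circ> inv_into V \<phi>))"

definition smooth_near ::
  "('m::{t2_space,second_countable_topology}, 'b::real_inner) chart set \<Rightarrow>
   'm \<Rightarrow> ('m \<Rightarrow> real) \<Rightarrow> bool" where
  "smooth_near A p f \<longleftrightarrow> (\<exists>W. open W \<and> p \<in> W \<and> smooth_fun A W f)"

text \<open>Tangent vectors at \<open>p\<close> are derivations of the algebra of germs at \<open>p\<close>, with value 0 by
  convention on functions that are not smooth near \<open>p\<close>.\<close>

definition tangent_space ::
  "('m::{t2_space,second_countable_topology}, 'b::real_inner) chart set \<Rightarrow>
   'm \<Rightarrow> (('m \<Rightarrow> real) \<Rightarrow> real) set" where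
  "tangent_space A p = {D.
     (\<forall>f. \<not> smooth_near A p f \<longrightarrow> D f = 0) \<and>
     (\<forall>f g. smooth_near A p f \<longrightarrow> smooth_near A p g \<longrightarrow>
        (\<forall>\<^sub>F q in nhds p. f q = g q) \<longrightarrow> D f = D g) \<and>
     (\<forall>f g. smooth_near A p f \<longrightarrow> smooth_near A p g \<longrightarrow> D (\<lambda>q. f q + g q) = D f + D g) \<and>
     (\<forall>c f. smooth_near A p f \<longrightarrow> D (\<lambda>q. c * f q) = c * D f) \<and>
     (\<forall>f g. smooth_near A p f \<longrightarrow> smooth_near A p g \<longrightarrow>
        D (\<lambda>q. f q * g q) = f p * D g + g p * D f)}"

text \<open>Smoothness of a vector field: its component vector \<open>c\<close> in each chart is smooth.\<close>

definition smooth_vector_field ::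
  "('m::{t2_space,second_countable_topology}, 'b::real_inner) chart set \<Rightarrow>
   'm set \<Rightarrow> ('m \<Rightarrow> ('m \<Rightarrow> real) \<Rightarrow> real) \<Rightarrow> bool" where
  "smooth_vector_field A U Y \<longleftrightarrow>
     (\<forall>p\<in>U. Y p \<in> tangent_space A p) \<and>
     (\<forall>(V,\<phi>)\<in>A. \<exists>c. smooth_fun A (U \<inter> V) c \<and>
        (\<forall>p\<in>U \<inter> V. \<forall>f. smooth_near A p f \<longrightarrow>
           Y p f = frechet_derivative (f \<circ> inv_into V \<phi>) (at (\<phi> p)) (c p)))"

definition vector_field_bracket ::
  "('m::{t2_space,second_countable_topology}, 'b::real_inner) chart set \<Rightarrow>
   ('m \<Rightarrow> ('m \<Rightarrow> real) \<Rightarrow> real) \<Rightarrow> ('m \<Rightarrow> ('m \<Rightarrow> real) \<Rightarrow> real) \<Rightarrow> 'm \<Rightarrow> ('m \<Rightarrow> real) \<Rightarrow> real" where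
  "vector_field_bracket A Y Z p f =
     (if smooth_near A p f then Y p (\<lambda>q. Z q f) - Z p (\<lambda>q. Y q f) else 0)"

section \<open>Vector bundles\<close>

text \<open>The fibre over \<open>p\<close> is a linear subspace of an ambient real vector space \<open>'v\<close> that carries no
  further structure; the smooth structure is given by a bundle atlas, each local trivialization being
  recorded as the frame \<open>(X a)\<close>, \<open>a < rk\<close>, that it identifies with the standard basis.\<close>

record ('m, 'b, 'v) vbundle =
  charts :: "('m, 'b) chart set"
  rk :: nat
  fibre :: "'m \<Rightarrow> 'v set"
  trivs :: "('m set \<times> (nat \<Rightarrow> 'm \<Rightarrow> 'v)) set"

definition pointwise_basis ::
  "('m::{t2_space,second_countable_topology}, 'b::real_inner, 'v::real_vector, 'z) vbundle_scheme \<Rightarrow>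
   'm set \<Rightarrow> (nat \<Rightarrow> 'm \<Rightarrow> 'v) \<Rightarrow> bool" where
  "pointwise_basis E U X \<longleftrightarrow>
     (\<forall>p\<in>U. inj_on (\<lambda>a. X a p) {..<rk E} \<and> independent ((\<lambda>a. X a p) ` {..<rk E}) \<and>
        span ((\<lambda>a. X a p) ` {..<rk E}) = fibre E p)"

definition vector_bundle ::
  "('m::{t2_space,second_countable_topology}, 'b::real_inner, 'v::real_vector, 'z) vbundle_scheme \<Rightarrow>
   bool" where
  "vector_bundle E \<longleftrightarrow>
     smooth_manifold (charts E) \<and>
     (\<forall>p. subspace (fibre E p)) \<and>
     (\<Union>(U,X)\<in>trivs E. U) = UNIV \<and>
     (\<forall>(U,X)\<in>trivs E. open U \<and> pointwise_basis E U X) \<and>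
     (\<forall>(U,X)\<in>trivs E. \<forall>(V,Y)\<in>trivs E. \<exists>g.
        (\<forall>a<rk E. \<forall>b<rk E. smooth_fun (charts E) (U \<inter> V) (g a b)) \<and>
        (\<forall>p\<in>U \<inter> V. \<forall>b<rk E. Y b p = (\<Sum>a<rk E. g a b p *\<^sub>R X a p)))"

text \<open>Sections over an open set \<open>U\<close>; values outside \<open>U\<close> are irrelevant.\<close>

definition local_section ::
  "('m::{t2_space,second_countable_topology}, 'b::real_inner, 'v::real_vector, 'z) vbundle_scheme \<Rightarrow>
   'm set \<Rightarrow> ('m \<Rightarrow> 'v) \<Rightarrow> bool" where
  "local_section E U s \<longleftrightarrow>
     (\<forall>p\<in>U. s p \<in> fibre E p) \<and>
     (\<forall>(V,X)\<in>trivs E. \<exists>c. (\<forall>a<rk E. smooth_fun (charts E) (U \<inter> V) (c a)) \<and>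
        (\<forall>p\<in>U \<inter> V. s p = (\<Sum>a<rk E. c a p *\<^sub>R X a p)))"

definition sections ::
  "('m::{t2_space,second_countable_topology}, 'b::real_inner, 'v::real_vector, 'z) vbundle_scheme \<Rightarrow>
   ('m \<Rightarrow> 'v) set" where
  "sections E = {s. local_section E UNIV s}"

definition smooth_functions ::
  "('m::{t2_space,second_countable_topology}, 'b::real_inner, 'v::real_vector, 'z) vbundle_scheme \<Rightarrow>
   ('m \<Rightarrow> real) set" where
  "smooth_functions E = {f. smooth_fun (charts E) UNIV f}"

text \<open>Sections of the dual bundle. Since \<open>'v\<close> may be larger than the fibre, covectors are
  extended by 0 outside of the fibre.\<close>

definition one_forms ::
  "('m::{t2_space,second_countable_topology}, 'b::real_inner, 'v::real_vector, 'z) vbundle_scheme \<Rightarrow>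
   ('m \<Rightarrow> 'v \<Rightarrow> real) set" where
  "one_forms E = {\<alpha>.
     (\<forall>p. (\<forall>x\<in>fibre E p. \<forall>y\<in>fibre E p. \<alpha> p (x + y) = \<alpha> p x + \<alpha> p y) \<and>
          (\<forall>c. \<forall>x\<in>fibre E p. \<alpha> p (c *\<^sub>R x) = c * \<alpha> p x) \<and>
          (\<forall>x. x \<notin> fibre E p \<longrightarrow> \<alpha> p x = 0)) \<and>
     (\<forall>(U,X)\<in>trivs E. \<forall>a<rk E. smooth_fun (charts E) U (\<lambda>p. \<alpha> p (X a p)))}"

definition local_frame ::
  "('m::{t2_space,second_countable_topology}, 'b::real_inner, 'v::real_vector, 'z) vbundle_scheme \<Rightarrow>
   'm set \<Rightarrow> (nat \<Rightarrow> 'm \<Rightarrow> 'v) \<Rightarrow> bool" where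
  "local_frame E U X \<longleftrightarrow>
     open U \<and> (\<forall>a<rk E. local_section E U (X a)) \<and> pointwise_basis E U X"

text \<open>\<open>dual_coframe E X a p\<close> maps a vector of the fibre to its coefficient at \<open>X a p\<close>, and is 0
  outside of the fibre (by definition of \<^const>\<open>representation\<close>).\<close>

definition dual_coframe ::
  "('m::{t2_space,second_countable_topology}, 'b::real_inner, 'v::real_vector, 'z) vbundle_scheme \<Rightarrow>
   (nat \<Rightarrow> 'm \<Rightarrow> 'v) \<Rightarrow> nat \<Rightarrow> 'm \<Rightarrow> 'v \<Rightarrow> real" where
  "dual_coframe E X a p x = representation ((\<lambda>b. X b p) ` {..<rk E}) x (X a p)"

definition Cinf_linear ::
  "('m::{t2_space,second_countable_topology}, 'b::real_inner, 'v::real_vector, 'z) vbundle_scheme \<Rightarrow>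
   (('m \<Rightarrow> 'v) \<Rightarrow> ('m \<Rightarrow> 'v)) \<Rightarrow> bool" where
  "Cinf_linear E F \<longleftrightarrow>
     (\<forall>s\<in>sections E. F s \<in> sections E) \<and>
     (\<forall>s\<in>sections E. \<forall>t\<in>sections E. F (\<lambda>p. s p + t p) = (\<lambda>p. F s p + F t p)) \<and>
     (\<forall>f\<in>smooth_functions E. \<forall>s\<in>sections E. F (\<lambda>p. f p *\<^sub>R s p) = (\<lambda>p. f p *\<^sub>R F s p))"

definition Cinf_linear_form ::
  "('m::{t2_space,second_countable_topology}, 'b::real_inner, 'v::real_vector, 'z) vbundle_scheme \<Rightarrow>
   (('m \<Rightarrow> 'v \<Rightarrow> real) \<Rightarrow> ('m \<Rightarrow> 'v)) \<Rightarrow> bool" where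
  "Cinf_linear_form E F \<longleftrightarrow>
     (\<forall>\<alpha>\<in>one_forms E. F \<alpha> \<in> sections E) \<and>
     (\<forall>\<alpha>\<in>one_forms E. \<forall>\<beta>\<in>one_forms E. F (\<lambda>p x. \<alpha> p x + \<beta> p x) = (\<lambda>p. F \<alpha> p + F \<beta> p)) \<and>
     (\<forall>f\<in>smooth_functions E. \<forall>\<alpha>\<in>one_forms E. F (\<lambda>p x. f p * \<alpha> p x) = (\<lambda>p. f p *\<^sub>R F \<alpha> p))"

definition R_linear ::
  "('m::{t2_space,second_countable_topology}, 'b::real_inner, 'v::real_vector, 'z) vbundle_scheme \<Rightarrow>
   (('m \<Rightarrow> 'v) \<Rightarrow> ('m \<Rightarrow> 'v)) \<Rightarrow> bool" where
  "R_linear E F \<longleftrightarrow>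
     (\<forall>s\<in>sections E. F s \<in> sections E) \<and>
     (\<forall>s\<in>sections E. \<forall>t\<in>sections E. F (\<lambda>p. s p + t p) = (\<lambda>p. F s p + F t p)) \<and>
     (\<forall>c. \<forall>s\<in>sections E. F (\<lambda>p. c *\<^sub>R s p) = (\<lambda>p. c *\<^sub>R F s p))"

definition R_bilinear ::
  "('m::{t2_space,second_countable_topology}, 'b::real_inner, 'v::real_vector, 'z) vbundle_scheme \<Rightarrow>
   (('m \<Rightarrow> 'v) \<Rightarrow> ('m \<Rightarrow> 'v) \<Rightarrow> ('m \<Rightarrow> 'v)) \<Rightarrow> bool" where
  "R_bilinear E B \<longleftrightarrow>
     (\<forall>u\<in>sections E. R_linear E (B u)) \<and> (\<forall>v\<in>sections E. R_linear E (\<lambda>u. B u v))"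

section \<open>Local pre-Leibniz algebroids\<close>

record ('m, 'b, 'v) anchored_bundle = "('m, 'b, 'v) vbundle" +
  anchor :: "'m \<Rightarrow> 'v \<Rightarrow> ('m \<Rightarrow> real) \<Rightarrow> real"

definition anchored_vector_bundle ::
  "('m::{t2_space,second_countable_topology}, 'b::real_inner, 'v::real_vector, 'z)
     anchored_bundle_scheme \<Rightarrow> bool" where
  "anchored_vector_bundle E \<longleftrightarrow>
     vector_bundle E \<and>
     (\<forall>p. \<forall>x\<in>fibre E p. anchor E p x \<in> tangent_space (charts E) p) \<and>
     (\<forall>p. \<forall>x\<in>fibre E p. \<forall>y\<in>fibre E p.
        anchor E p (x + y) = (\<lambda>f. anchor E p x f + anchor E p y f)) \<and>
     (\<forall>p c. \<forall>x\<in>fibre E p. anchor E p (c *\<^sub>R x) = (\<lambda>f. c * anchor E p x f)) \<and>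
     (\<forall>(U,X)\<in>trivs E. \<forall>a<rk E. smooth_vector_field (charts E) U (\<lambda>p. anchor E p (X a p)))"

text \<open>The function \<open>\<rho>(u)(f)\<close>.\<close>

definition act ::
  "('m::{t2_space,second_countable_topology}, 'b::real_inner, 'v::real_vector, 'z)
     anchored_bundle_scheme \<Rightarrow> ('m \<Rightarrow> 'v) \<Rightarrow> ('m \<Rightarrow> real) \<Rightarrow> 'm \<Rightarrow> real" where
  "act E u f p = anchor E p (u p) f"

definition anchor_kernel ::
  "('m::{t2_space,second_countable_topology}, 'b::real_inner, 'v::real_vector, 'z)
     anchored_bundle_scheme \<Rightarrow> 'm \<Rightarrow> 'v set" where
  "anchor_kernel E p = {x \<in> fibre E p. anchor E p x = (\<lambda>f. 0)}"

definition regular ::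
  "('m::{t2_space,second_countable_topology}, 'b::real_inner, 'v::real_vector, 'z)
     anchored_bundle_scheme \<Rightarrow> bool" where
  "regular E \<longleftrightarrow> (\<forall>p. \<forall>\<^sub>F q in nhds p. dim (anchor_kernel E q) = dim (anchor_kernel E p))"

text \<open>The one-form \<open>Df\<close>, extended by 0 outside of the fibres.\<close>

definition differential ::
  "('m::{t2_space,second_countable_topology}, 'b::real_inner, 'v::real_vector, 'z)
     anchored_bundle_scheme \<Rightarrow> ('m \<Rightarrow> real) \<Rightarrow> 'm \<Rightarrow> 'v \<Rightarrow> real" where
  "differential E f p x = (if x \<in> fibre E p then anchor E p x f else 0)"

record ('m, 'b, 'v) algebroid = "('m, 'b, 'v) anchored_bundle" +
  bracket :: "('m \<Rightarrow> 'v) \<Rightarrow> ('m \<Rightarrow> 'v) \<Rightarrow> ('m \<Rightarrow> 'v)"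

definition pre_leibniz_algebroid ::
  "('m::{t2_space,second_countable_topology}, 'b::real_inner, 'v::real_vector, 'z)
     algebroid_scheme \<Rightarrow> bool" where
  "pre_leibniz_algebroid E \<longleftrightarrow>
     anchored_vector_bundle E \<and>
     R_bilinear E (bracket E) \<and>
     (\<forall>u\<in>sections E. \<forall>v\<in>sections E. \<forall>f\<in>smooth_functions E.
        bracket E u (\<lambda>p. f p *\<^sub>R v p) = (\<lambda>p. act E u f p *\<^sub>R v p + f p *\<^sub>R bracket E u v p)) \<and>
     (\<forall>u\<in>sections E. \<forall>v\<in>sections E.
        (\<lambda>p. anchor E p (bracket E u v p)) =
        vector_field_bracket (charts E) (\<lambda>p. anchor E p (u p)) (\<lambda>p. anchor E p (v p)))"

record ('m, 'b, 'v) local_algebroid = "('m, 'b, 'v) algebroid" +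
  locality :: "('m \<Rightarrow> 'v \<Rightarrow> real) \<Rightarrow> ('m \<Rightarrow> 'v) \<Rightarrow> ('m \<Rightarrow> 'v) \<Rightarrow> ('m \<Rightarrow> 'v)"

definition local_pre_leibniz_algebroid ::
  "('m::{t2_space,second_countable_topology}, 'b::real_inner, 'v::real_vector, 'z)
     local_algebroid_scheme \<Rightarrow> bool" where
  "local_pre_leibniz_algebroid E \<longleftrightarrow>
     pre_leibniz_algebroid E \<and>
     (\<forall>u\<in>sections E. \<forall>v\<in>sections E. Cinf_linear_form E (\<lambda>\<alpha>. locality E \<alpha> u v)) \<and>
     (\<forall>\<alpha>\<in>one_forms E. \<forall>v\<in>sections E. Cinf_linear E (\<lambda>u. locality E \<alpha> u v)) \<and>
     (\<forall>\<alpha>\<in>one_forms E. \<forall>u\<in>sections E. Cinf_linear E (\<lambda>v. locality E \<alpha> u v)) \<and>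
     (\<forall>u\<in>sections E. \<forall>v\<in>sections E. \<forall>f\<in>smooth_functions E.
        bracket E (\<lambda>p. f p *\<^sub>R u p) v =
        (\<lambda>p. - act E v f p *\<^sub>R u p + f p *\<^sub>R bracket E u v p
             + locality E (differential E f) u v p))"

definition projected_locality ::
  "('m::{t2_space,second_countable_topology}, 'b::real_inner, 'v::real_vector, 'z)
     local_algebroid_scheme \<Rightarrow> (('m \<Rightarrow> 'v) \<Rightarrow> ('m \<Rightarrow> 'v)) \<Rightarrow>
   ('m \<Rightarrow> 'v \<Rightarrow> real) \<Rightarrow> ('m \<Rightarrow> 'v) \<Rightarrow> ('m \<Rightarrow> 'v) \<Rightarrow> ('m \<Rightarrow> 'v)" where
  "projected_locality E P \<alpha> u v = P (locality E \<alpha> u v)"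

definition locality_projector ::
  "('m::{t2_space,second_countable_topology}, 'b::real_inner, 'v::real_vector, 'z)
     local_algebroid_scheme \<Rightarrow> (('m \<Rightarrow> 'v) \<Rightarrow> ('m \<Rightarrow> 'v)) \<Rightarrow> bool" where
  "locality_projector E P \<longleftrightarrow>
     Cinf_linear E P \<and>
     (\<forall>\<alpha>\<in>one_forms E. \<forall>u\<in>sections E. \<forall>v\<in>sections E. \<forall>p.
        projected_locality E P \<alpha> u v p \<in> anchor_kernel E p) \<and>
     (\<forall>u\<in>sections E. (\<forall>p. u p \<in> anchor_kernel E p) \<longrightarrow> P u = u)"

definition linear_connection ::
  "('m::{t2_space,second_countable_topology}, 'b::real_inner, 'v::real_vector, 'z)
     anchored_bundle_scheme \<Rightarrow> (('m \<Rightarrow> 'v) \<Rightarrow> ('m \<Rightarrow> 'v) \<Rightarrow> ('m \<Rightarrow> 'v)) \<Rightarrow> bool" where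
  "linear_connection E nab \<longleftrightarrow>
     R_bilinear E nab \<and>
     (\<forall>u\<in>sections E. \<forall>v\<in>sections E. \<forall>f\<in>smooth_functions E.
        nab u (\<lambda>p. f p *\<^sub>R v p) = (\<lambda>p. act E u f p *\<^sub>R v p + f p *\<^sub>R nab u v p) \<and>
        nab (\<lambda>p. f p *\<^sub>R u p) v = (\<lambda>p. f p *\<^sub>R nab u v p))"

section \<open>Operators on local sections\<close>

text \<open>The bracket, the connection and the locality operator are given on global sections and are
  local operators. They are restricted to sections over an open set by evaluating them, at each point
  \<open>p\<close>, on global sections (or one-forms) with the same germ at \<open>p\<close>.\<close>

definition germ_ext ::
  "('m::{t2_space,second_countable_topology}, 'b::real_inner, 'v::real_vector, 'z) vbundle_scheme \<Rightarrow>
   'm \<Rightarrow> ('m \<Rightarrow> 'v) \<Rightarrow> ('m \<Rightarrow> 'v)" where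
  "germ_ext E p u = (SOME s. s \<in> sections E \<and> (\<forall>\<^sub>F q in nhds p. s q = u q))"

definition germ_ext_form ::
  "('m::{t2_space,second_countable_topology}, 'b::real_inner, 'v::real_vector, 'z) vbundle_scheme \<Rightarrow>
   'm \<Rightarrow> ('m \<Rightarrow> 'v \<Rightarrow> real) \<Rightarrow> ('m \<Rightarrow> 'v \<Rightarrow> real)" where
  "germ_ext_form E p \<alpha> = (SOME \<beta>. \<beta> \<in> one_forms E \<and> (\<forall>\<^sub>F q in nhds p. \<beta> q = \<alpha> q))"

definition restr2 ::
  "('m::{t2_space,second_countable_topology}, 'b::real_inner, 'v::real_vector, 'z) vbundle_scheme \<Rightarrow>
   (('m \<Rightarrow> 'v) \<Rightarrow> ('m \<Rightarrow> 'v) \<Rightarrow> ('m \<Rightarrow> 'v)) \<Rightarrow> ('m \<Rightarrow> 'v) \<Rightarrow> ('m \<Rightarrow> 'v) \<Rightarrow> ('m \<Rightarrow> 'v)" where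
  "restr2 E B u v = (\<lambda>p. B (germ_ext E p u) (germ_ext E p v) p)"

definition restr3 ::
  "('m::{t2_space,second_countable_topology}, 'b::real_inner, 'v::real_vector, 'z) vbundle_scheme \<Rightarrow>
   (('m \<Rightarrow> 'v \<Rightarrow> real) \<Rightarrow> ('m \<Rightarrow> 'v) \<Rightarrow> ('m \<Rightarrow> 'v) \<Rightarrow> ('m \<Rightarrow> 'v)) \<Rightarrow>
   ('m \<Rightarrow> 'v \<Rightarrow> real) \<Rightarrow> ('m \<Rightarrow> 'v) \<Rightarrow> ('m \<Rightarrow> 'v) \<Rightarrow> ('m \<Rightarrow> 'v)" where
  "restr3 E K \<alpha> u v = (\<lambda>p. K (germ_ext_form E p \<alpha>) (germ_ext E p u) (germ_ext E p v) p)"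

text \<open>The section \<open>K(e\<^sup>a, \<nabla>\<^bsub>X\<^sub>a\<^esub>u, v)\<close>, summed over \<open>a\<close>, for \<open>K = L\<close> or \<open>K = \<P>L\<close>.
  Its value at \<open>p\<close> does not depend on the frame around \<open>p\<close>, so an arbitrary one is used.\<close>

definition some_frame_at ::
  "('m::{t2_space,second_countable_topology}, 'b::real_inner, 'v::real_vector, 'z) vbundle_scheme \<Rightarrow>
   'm \<Rightarrow> nat \<Rightarrow> 'm \<Rightarrow> 'v" where
  "some_frame_at E p = (SOME X. \<exists>U. p \<in> U \<and> local_frame E U X)"

definition frame_contraction ::
  "('m::{t2_space,second_countable_topology}, 'b::real_inner, 'v::real_vector, 'z) vbundle_scheme \<Rightarrow>
   (('m \<Rightarrow> 'v \<Rightarrow> real) \<Rightarrow> ('m \<Rightarrow> 'v) \<Rightarrow> ('m \<Rightarrow> 'v) \<Rightarrow> ('m \<Rightarrow> 'v)) \<Rightarrow>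
   (('m \<Rightarrow> 'v) \<Rightarrow> ('m \<Rightarrow> 'v) \<Rightarrow> ('m \<Rightarrow> 'v)) \<Rightarrow> ('m \<Rightarrow> 'v) \<Rightarrow> ('m \<Rightarrow> 'v) \<Rightarrow> ('m \<Rightarrow> 'v)" where
  "frame_contraction E K nab u v = (\<lambda>p. let X = some_frame_at E p in
     (\<Sum>a<rk E. restr3 E K (dual_coframe E X a) (restr2 E nab (X a) u) v p))"

definition admissible ::
  "('m::{t2_space,second_countable_topology}, 'b::real_inner, 'v::real_vector, 'z)
     local_algebroid_scheme \<Rightarrow> (('m \<Rightarrow> 'v) \<Rightarrow> ('m \<Rightarrow> 'v) \<Rightarrow> ('m \<Rightarrow> 'v)) \<Rightarrow> bool" where
  "admissible E nab \<longleftrightarrow>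
     (\<forall>u\<in>sections E. \<forall>v\<in>sections E.
        (\<lambda>p. bracket E u v p + bracket E v u p) =
        (\<lambda>p. frame_contraction E (locality E) nab u v p
             + frame_contraction E (locality E) nab v u p))"

definition modified_bracket ::
  "('m::{t2_space,second_countable_topology}, 'b::real_inner, 'v::real_vector, 'z)
     local_algebroid_scheme \<Rightarrow> (('m \<Rightarrow> 'v) \<Rightarrow> ('m \<Rightarrow> 'v) \<Rightarrow> ('m \<Rightarrow> 'v)) \<Rightarrow>
   ('m \<Rightarrow> 'v) \<Rightarrow> ('m \<Rightarrow> 'v) \<Rightarrow> ('m \<Rightarrow> 'v)" where
  "modified_bracket E nab u v =
     (\<lambda>p. restr2 E (bracket E) u v p - frame_contraction E (locality E) nab u v p)"

definition projected_modified_bracket ::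
  "('m::{t2_space,second_countable_topology}, 'b::real_inner, 'v::real_vector, 'z)
     local_algebroid_scheme \<Rightarrow> (('m \<Rightarrow> 'v) \<Rightarrow> ('m \<Rightarrow> 'v)) \<Rightarrow>
   (('m \<Rightarrow> 'v) \<Rightarrow> ('m \<Rightarrow> 'v) \<Rightarrow> ('m \<Rightarrow> 'v)) \<Rightarrow> ('m \<Rightarrow> 'v) \<Rightarrow> ('m \<Rightarrow> 'v) \<Rightarrow> ('m \<Rightarrow> 'v)" where
  "projected_modified_bracket E P nab u v =
     (\<lambda>p. restr2 E (bracket E) u v p - frame_contraction E (projected_locality E P) nab u v p)"

definition torsion ::
  "('m::{t2_space,second_countable_topology}, 'b::real_inner, 'v::real_vector, 'z)
     local_algebroid_scheme \<Rightarrow> (('m \<Rightarrow> 'v) \<Rightarrow> ('m \<Rightarrow> 'v) \<Rightarrow> ('m \<Rightarrow> 'v)) \<Rightarrow>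
   ('m \<Rightarrow> 'v) \<Rightarrow> ('m \<Rightarrow> 'v) \<Rightarrow> ('m \<Rightarrow> 'v)" where
  "torsion E nab u v =
     (\<lambda>p. restr2 E nab u v p - restr2 E nab v u p - modified_bracket E nab u v p)"

definition curvature ::
  "('m::{t2_space,second_countable_topology}, 'b::real_inner, 'v::real_vector, 'z)
     local_algebroid_scheme \<Rightarrow> (('m \<Rightarrow> 'v) \<Rightarrow> ('m \<Rightarrow> 'v)) \<Rightarrow>
   (('m \<Rightarrow> 'v) \<Rightarrow> ('m \<Rightarrow> 'v) \<Rightarrow> ('m \<Rightarrow> 'v)) \<Rightarrow>
   ('m \<Rightarrow> 'v) \<Rightarrow> ('m \<Rightarrow> 'v) \<Rightarrow> ('m \<Rightarrow> 'v) \<Rightarrow> ('m \<Rightarrow> 'v)" where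
  "curvature E P nab u v w =
     (\<lambda>p. restr2 E nab u (restr2 E nab v w) p - restr2 E nab v (restr2 E nab u w) p
          - restr2 E nab (projected_modified_bracket E P nab u v) w p)"

section \<open>Forms\<close>

text \<open>A \<open>p\<close>-form on an open set is represented by its values on lists of \<open>p\<close> sections over that
  set.\<close>

type_synonym ('m, 'v) form = "('m \<Rightarrow> 'v) list \<Rightarrow> 'm \<Rightarrow> real"

definition form1 :: "('m \<Rightarrow> 'v \<Rightarrow> real) \<Rightarrow> ('m, 'v) form" where
  "form1 \<alpha> vs p = \<alpha> p ((vs ! 0) p)"

definition wedge :: "('m, 'v) form \<Rightarrow> ('m, 'v) form \<Rightarrow> ('m, 'v) form" where
  "wedge \<alpha> \<beta> vs p = \<alpha> [vs ! 0] p * \<beta> [vs ! 1] p - \<alpha> [vs ! 1] p * \<beta> [vs ! 0] p"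

definition omit :: "nat \<Rightarrow> 'a list \<Rightarrow> 'a list" where
  "omit i xs = take i xs @ drop (Suc i) xs"

text \<open>List positions start at 0, whence the sign \<open>(-1)^i\<close> in the first sum. In the second
  sum \<open>i < j\<close>, so position \<open>j\<close> has to be removed first.\<close>

definition ext_deriv ::
  "('m::{t2_space,second_countable_topology}, 'b::real_inner, 'v::real_vector, 'z)
     anchored_bundle_scheme \<Rightarrow> (('m \<Rightarrow> 'v) \<Rightarrow> ('m \<Rightarrow> 'v) \<Rightarrow> ('m \<Rightarrow> 'v)) \<Rightarrow>
   ('m, 'v) form \<Rightarrow> ('m, 'v) form" where
  "ext_deriv E br \<Omega> vs p =
     (\<Sum>i<length vs. (-1) ^ i * act E (vs ! i) (\<Omega> (omit i vs)) p)
     + (\<Sum>j<length vs. \<Sum>i<j. (-1) ^ (i + j) * \<Omega> (br (vs ! i) (vs ! j) # omit i (omit j vs)) p)"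

definition d_nab ::
  "('m::{t2_space,second_countable_topology}, 'b::real_inner, 'v::real_vector, 'z)
     local_algebroid_scheme \<Rightarrow> (('m \<Rightarrow> 'v) \<Rightarrow> ('m \<Rightarrow> 'v) \<Rightarrow> ('m \<Rightarrow> 'v)) \<Rightarrow>
   ('m, 'v) form \<Rightarrow> ('m, 'v) form" where
  "d_nab E nab = ext_deriv E (modified_bracket E nab)"

definition d_hat_nab ::
  "('m::{t2_space,second_countable_topology}, 'b::real_inner, 'v::real_vector, 'z)
     local_algebroid_scheme \<Rightarrow> (('m \<Rightarrow> 'v) \<Rightarrow> ('m \<Rightarrow> 'v)) \<Rightarrow>
   (('m \<Rightarrow> 'v) \<Rightarrow> ('m \<Rightarrow> 'v) \<Rightarrow> ('m \<Rightarrow> 'v)) \<Rightarrow> ('m, 'v) form \<Rightarrow> ('m, 'v) form" where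
  "d_hat_nab E P nab = ext_deriv E (projected_modified_bracket E P nab)"

text \<open>The forms \<open>T\<^sup>a\<close>, \<open>R\<^sup>a\<^sub>b\<close>, \<open>\<omega>\<^sup>a\<^sub>b\<close> with respect to a local frame \<open>X\<close>.\<close>

definition torsion_form ::
  "('m::{t2_space,second_countable_topology}, 'b::real_inner, 'v::real_vector, 'z)
     local_algebroid_scheme \<Rightarrow> (('m \<Rightarrow> 'v) \<Rightarrow> ('m \<Rightarrow> 'v) \<Rightarrow> ('m \<Rightarrow> 'v)) \<Rightarrow>
   (nat \<Rightarrow> 'm \<Rightarrow> 'v) \<Rightarrow> nat \<Rightarrow> ('m, 'v) form" where
  "torsion_form E nab X a vs p = dual_coframe E X a p (torsion E nab (vs ! 0) (vs ! 1) p)"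

definition curvature_form ::
  "('m::{t2_space,second_countable_topology}, 'b::real_inner, 'v::real_vector, 'z)
     local_algebroid_scheme \<Rightarrow> (('m \<Rightarrow> 'v) \<Rightarrow> ('m \<Rightarrow> 'v)) \<Rightarrow>
   (('m \<Rightarrow> 'v) \<Rightarrow> ('m \<Rightarrow> 'v) \<Rightarrow> ('m \<Rightarrow> 'v)) \<Rightarrow> (nat \<Rightarrow> 'm \<Rightarrow> 'v) \<Rightarrow> nat \<Rightarrow> nat \<Rightarrow> ('m, 'v) form" where
  "curvature_form E P nab X a b vs p =
     dual_coframe E X a p (curvature E P nab (vs ! 0) (vs ! 1) (X b) p)"

definition connection_form ::
  "('m::{t2_space,second_countable_topology}, 'b::real_inner, 'v::real_vector, 'z)
     anchored_bundle_scheme \<Rightarrow> (('m \<Rightarrow> 'v) \<Rightarrow> ('m \<Rightarrow> 'v) \<Rightarrow> ('m \<Rightarrow> 'v)) \<Rightarrow>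
   (nat \<Rightarrow> 'm \<Rightarrow> 'v) \<Rightarrow> nat \<Rightarrow> nat \<Rightarrow> ('m, 'v) form" where
  "connection_form E nab X a b vs p = dual_coframe E X a p (restr2 E nab (vs ! 0) (X b) p)"

end

theory Submission
  imports Defs "HOL-Computational_Algebra.Polynomial" "Jordan_Normal_Form.Determinant"
begin

text \<open>For local sections \<open>u\<close>, \<open>v\<close> the Leibniz rule gives, at each point of a local frame,
  \<open>e\<^sup>a(\<nabla>\<^sub>u v) = \<rho>(u)(e\<^sup>a(v)) + \<omega>\<^sup>a\<^sub>c(u) e\<^sup>c(v)\<close>. Applied to \<open>\<nabla>\<^sub>u v - \<nabla>\<^sub>v u\<close> this is the first structure
  equation; applied to \<open>\<nabla>\<^sub>u (\<nabla>\<^sub>v X\<^sub>b) - \<nabla>\<^sub>v (\<nabla>\<^sub>u X\<^sub>b)\<close> it is the second.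

  What needs work is that all the operators make sense on local sections. Bump functions extend germs of
  sections and of coframes, and show that \<open>\<nabla>\<close>, the bracket and the contractions
  \<open>L(e\<^sup>a, \<nabla>\<^bsub>X\<^sub>a\<^esub>u, v)\<close> are local; for the first argument of the bracket, admissibility reduces this to the
  second argument. Smoothness of the dual coframe is Cramer's rule.\<close>

section \<open>Calculus of \<open>C\<^sup>k\<close> maps\<close>

text \<open>The operators on local sections are evaluated point by point: at every p global
  extensions are chosen by \<open>germ_ext\<close>, and \<open>frame_contraction\<close> also
  chooses a frame at every p. Choices at neighbouring points are unrelated, so a priori
  \<open>restr2 E nab v (X b)\<close> need not be smooth, and a second covariant derivative of it
  would be meaningless. Locality repairs this: near p, one fixed pair of global sections produces
  all the values. A contraction depends only on germs by construction, but its smoothness needs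
  independence of the frame, because the chosen frame jumps from point to point. These facts are
  spent in two places: on the iterated derivative in the curvature, and on the additivity of the
  dual coframe, which holds only on the fibres. Since frames and coframes are local while the
  operators accept global arguments, every expansion in a frame carries two cutoffs, one in the
  coefficient and one in the frame vector, or replaces the frame vectors by global extensions of
  their germs.\<close>

lemma Ck_on_subset: "Ck_on k S f \<Longrightarrow> T \<subseteq> S \<Longrightarrow> Ck_on k T f"
proof (induction k arbitrary: f)
  case 0
  then show ?case by (simp add: continuous_on_subset)
next
  case (Suc k)
  then show ?case by (simp add: subset_iff)
qed

lemma Ck_on_SucD: "Ck_on (Suc k) S f \<Longrightarrow> Ck_on k S f"
proof (induction k arbitrary: f)
  case 0
  then show ?case
    by (auto intro!: continuous_at_imp_continuous_on differentiable_imp_continuous_within)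
next
  case (Suc k)
  then show ?case by (metis Ck_on.simps(2))
qed

lemma frechet_derivative_cong_open:
  assumes "open S" "x \<in> S" "\<And>y. y \<in> S \<Longrightarrow> f y = g y"
  shows "frechet_derivative f (at x) = frechet_derivative g (at x)"
proof -
  \<comment> \<open>Both functions have the same set of derivatives at x, so the choice inside
    \<open>frechet_derivative\<close> returns the same map, differentiable or not.\<close>
  have "(f has_derivative D) (at x) \<longleftrightarrow> (g has_derivative D) (at x)" for D
    using assms has_derivative_transform_within_open[of f D x UNIV S g]
      has_derivative_transform_within_open[of g D x UNIV S f] by auto
  then show ?thesis by (simp add: frechet_derivative_def)
qed

lemma differentiable_cong_open:
  assumes "open S" "x \<in> S" "\<And>y. y \<in> S \<Longrightarrow> f y = g y" "f differentiable (at x)"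
  shows "g differentiable (at x)"
proof -
  obtain D where "(f has_derivative D) (at x)" using assms(4) by (auto simp: differentiable_def)
  then have "(g has_derivative D) (at x)"
    by (rule has_derivative_transform_within_open[OF _ assms(1-3)])
  then show ?thesis by (auto simp: differentiable_def)
qed

lemma Ck_on_cong:
  assumes "open S" "\<And>x. x \<in> S \<Longrightarrow> f x = g x" "Ck_on k S f"
  shows "Ck_on k S g"
  using assms(2,3)
proof (induction k arbitrary: f g)
  case 0
  then show ?case by (simp cong: continuous_on_cong)
next
  case (Suc k)
  have "frechet_derivative f (at x) = frechet_derivative g (at x)" if "x \<in> S" for x
    using frechet_derivative_cong_open[OF assms(1) that] Suc.prems(1) by blast
  then have "Ck_on k S (\<lambda>x. frechet_derivative g (at x) w)" for w
    using Suc.IH[of "\<lambda>x. frechet_derivative f (at x) w" "\<lambda>x. frechet_derivative g (at x) w"] Suc.prems(2)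
    by simp
  moreover have "g differentiable (at x)" if "x \<in> S" for x
    using differentiable_cong_open[OF assms(1) that, of f g] Suc.prems that by simp
  ultimately show ?case by simp
qed

lemma Ck_on_local:
  assumes "\<And>x. x \<in> S \<Longrightarrow> \<exists>T. open T \<and> x \<in> T \<and> Ck_on k T f"
  shows "Ck_on k S f"
  using assms
proof (induction k arbitrary: f)
  case 0
  show ?case
    by (simp, rule continuous_at_imp_continuous_on)
      (metis 0 Ck_on.simps(1) continuous_on_eq_continuous_at)
next
  case (Suc k)
  have "f differentiable (at x)" if "x \<in> S" for x
    using Suc.prems[OF that] by auto
  moreover have "Ck_on k S (\<lambda>x. frechet_derivative f (at x) w)" for w
  proof (rule Suc.IH)
    fix x assume "x \<in> S"
    then obtain T where "open T" "x \<in> T" "Ck_on (Suc k) T f" using Suc.prems by blast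
    then show "\<exists>T. open T \<and> x \<in> T \<and> Ck_on k T (\<lambda>x. frechet_derivative f (at x) w)" by auto
  qed
  ultimately show ?case by simp
qed

text \<open>\<open>Ck_on\<close> recurses through the chosen \<open>frechet_derivative\<close>. A
  derivative known by a formula is identified with it by uniqueness, and openness of S lets this
  equality on S pass to the higher derivatives.\<close>

lemma Ck_on_SucI:
  assumes "open S" "\<And>x. x \<in> S \<Longrightarrow> (f has_derivative D x) (at x)"
    "\<And>w. Ck_on k S (\<lambda>x. D x w)"
  shows "Ck_on (Suc k) S f"
proof -
  have "frechet_derivative f (at x) = D x" if "x \<in> S" for x
    using frechet_derivative_at[OF assms(2)[OF that]] by simp
  then have "Ck_on k S (\<lambda>x. frechet_derivative f (at x) w)" for w
    by (intro Ck_on_cong[OF assms(1) _ assms(3)]) simp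
  then show ?thesis using assms(2) by (auto simp: differentiable_def)
qed

lemma Ck_on_Suc_has_derivative:
  assumes "Ck_on (Suc k) S f" "x \<in> S"
  shows "(f has_derivative frechet_derivative f (at x)) (at x)"
  using assms by (simp flip: frechet_derivative_works)

lemma Ck_on_const: "open S \<Longrightarrow> Ck_on k S (\<lambda>_. c)"
proof (induction k arbitrary: c)
  case (Suc k)
  show ?case by (rule Ck_on_SucI[where D="\<lambda>_ _. 0"]) (auto simp: Suc)
qed simp

lemma Ck_on_add:
  assumes "open S" "Ck_on k S f" "Ck_on k S g"
  shows "Ck_on k S (\<lambda>x. f x + g x)"
  using assms(2,3)
proof (induction k arbitrary: f g)
  case 0
  then show ?case by (simp add: continuous_on_add)
next
  case (Suc k)
  note d = Ck_on_Suc_has_derivative[OF Suc.prems(1)] Ck_on_Suc_has_derivative[OF Suc.prems(2)]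
  show ?case
    by (rule Ck_on_SucI[OF assms(1) has_derivative_add[OF d]])
      (use Suc in \<open>auto\<close>)
qed

text \<open>Stated for bounded bilinear maps to serve both multiplication of real functions and the
  inner product, which enters through the squared distance in a chart.\<close>

lemma (in bounded_bilinear) Ck_on_prod:
  assumes "open S" "Ck_on k S f" "Ck_on k S g"
  shows "Ck_on k S (\<lambda>x. prod (f x) (g x))"
  using assms(2,3)
proof (induction k arbitrary: f g)
  case 0
  then show ?case by (simp add: continuous_on)
next
  case (Suc k)
  note d = Ck_on_Suc_has_derivative[OF Suc.prems(1)] Ck_on_Suc_has_derivative[OF Suc.prems(2)]
  have k: "Ck_on k S f" "Ck_on k S g"
    "Ck_on k S (\<lambda>x. frechet_derivative f (at x) w)" "Ck_on k S (\<lambda>x. frechet_derivative g (at x) w)" for w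
    using Suc.prems Ck_on_SucD[OF Suc.prems(1)] Ck_on_SucD[OF Suc.prems(2)] by auto
  show ?case
    by (rule Ck_on_SucI[OF assms(1) FDERIV[OF d]], assumption, assumption)
      (rule Ck_on_add[OF assms(1) Suc.IH[OF k(1) k(4)] Suc.IH[OF k(3) k(2)]])
qed

text \<open>The sequence \<open>H\<close> lists the successive derivatives of the outer function.\<close>

lemma Ck_on_compose:
  fixes f :: "'a::real_normed_vector \<Rightarrow> real" and H :: "nat \<Rightarrow> real \<Rightarrow> real"
  assumes "open S" "Ck_on k S f" "\<And>n x. x \<in> S \<Longrightarrow> (H n has_real_derivative H (Suc n) (f x)) (at (f x))"
  shows "Ck_on k S (\<lambda>x. H n (f x))"
  \<comment> \<open>The induction keeps n arbitrary, since the derivative of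
    \<open>H n (f x)\<close> contains \<open>H (Suc n) (f x)\<close>.\<close>
  using assms(2)
proof (induction k arbitrary: n)
  case 0
  have "isCont (\<lambda>x. H n (f x)) x" if "x \<in> S" for x
  proof (rule isCont_o2[where g="H n"])
    show "isCont f x" using 0 that assms(1) by (simp add: continuous_on_eq_continuous_at)
    show "isCont (H n) (f x)" using assms(3)[OF that] by (rule DERIV_isCont)
  qed
  then show ?case by (simp add: continuous_at_imp_continuous_on)
next
  case (Suc k)
  have d: "((\<lambda>x. H n (f x)) has_derivative (\<lambda>w. H (Suc n) (f x) * frechet_derivative f (at x) w)) (at x)"
    if "x \<in> S" for x
    using has_derivative_compose[OF Ck_on_Suc_has_derivative[OF Suc.prems that],
        of "H n" "(*) (H (Suc n) (f x))"] assms(3)[OF that, of n]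
    by (simp add: has_field_derivative_def)
  have "Ck_on k S (\<lambda>x. frechet_derivative f (at x) w)" for w
    using Suc.prems by simp
  then have "Ck_on k S (\<lambda>x. H (Suc n) (f x) * frechet_derivative f (at x) w)" for w
    by (intro bounded_bilinear.Ck_on_prod[OF bounded_bilinear_mult assms(1) Suc.IH[OF Ck_on_SucD[OF Suc.prems]]])
  then show ?case
    by (intro Ck_on_SucI[OF assms(1), of "\<lambda>x. H n (f x)" "\<lambda>x w. H (Suc n) (f x) * frechet_derivative f (at x) w"] d)
qed

lemma Ck_on_inverse:
  fixes f :: "'a::real_normed_vector \<Rightarrow> real"
  assumes "open S" "Ck_on k S f" "\<And>x. x \<in> S \<Longrightarrow> f x \<noteq> 0"
  shows "Ck_on k S (\<lambda>x. inverse (f x))"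
proof -
  define H where "H n t = (-1) ^ n * fact n * inverse t ^ Suc n" for n and t :: real
  have "(H n has_real_derivative H (Suc n) t) (at t)" if "t \<noteq> 0" for n t
  proof -
    have "((\<lambda>t. (-1) ^ n * fact n * inverse t ^ Suc n) has_real_derivative
      (-1) ^ n * fact n * (real (Suc n) * inverse t ^ n * - (inverse t ^ Suc (Suc 0)))) (at t)"
      using DERIV_power_Suc[OF DERIV_inverse[OF that], of n]
      by (intro DERIV_cmult) (simp add: mult_ac)
    then show ?thesis by (simp add: H_def [abs_def] algebra_simps)
  qed
  then have "Ck_on k S (\<lambda>x. H 0 (f x))"
    by (intro Ck_on_compose[where H=H, OF assms(1,2)]) (simp add: assms(3))
  then show ?thesis by (simp add: H_def)
qed

section \<open>Bump functions\<close>

text \<open>With s = 1/t, differentiating p(s) exp(-s) with respect to t gives s^2 (p(s) - p'(s))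
  exp(-s). The iterated operator is this rule on polynomials in s, started at 1.\<close>

definition flat_pol :: "nat \<Rightarrow> real poly" where
  "flat_pol n = ((\<lambda>p. [:0, 0, 1:] * (p - pderiv p)) ^^ n) 1"

text \<open>\<open>flat n\<close> is the \<open>n\<close>-th derivative of \<open>t \<mapsto> exp (-1/t)\<close>, extended by 0 to \<open>t \<le> 0\<close>.\<close>

definition flat :: "nat \<Rightarrow> real \<Rightarrow> real" where
  "flat n t = (if t \<le> 0 then 0 else poly (flat_pol n) (inverse t) * exp (- inverse t))"

lemma poly_times_exp_minus_tendsto_0:
  fixes p :: "real poly"
  shows "((\<lambda>s. poly p s * exp (- s)) \<longlongrightarrow> 0) at_top"
proof -
  have "((\<lambda>s. \<Sum>i\<le>degree p. coeff p i * (s ^ i / exp s)) \<longlongrightarrow> (\<Sum>i\<le>degree p. coeff p i * 0)) at_top"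
    by (intro tendsto_intros tendsto_power_div_exp_0)
  moreover have "(\<lambda>s. \<Sum>i\<le>degree p. coeff p i * (s ^ i / exp s)) = (\<lambda>s. poly p s * exp (- s))"
    by (simp add: poly_altdef sum_distrib_right exp_minus divide_inverse mult.assoc)
  ultimately show ?thesis by simp
qed

lemma flat_has_derivative: "(flat n has_real_derivative flat (Suc n) t) (at t)"
proof -
  consider "t < 0" | "t = 0" | "t > 0" by linarith
  then show ?thesis
  proof cases
    case 1
    have "((\<lambda>_. 0) has_real_derivative 0) (at t)" by simp
    then have "(flat n has_real_derivative 0) (at t)"
      by (rule has_field_derivative_transform_within_open[of _ _ _ "{..<0}"]) (use 1 in \<open>auto simp: flat_def\<close>)
    then show ?thesis using 1 by (simp add: flat_def)
  next
    case 2
    \<comment> \<open>In the variable 1/s the difference quotient at 0 is again a polynomial times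
      an exponential: dividing by s multiplies the polynomial by its variable, which is
      \<open>pCons 0\<close>.\<close>
    have r: "((\<lambda>s. poly (pCons 0 (flat_pol n)) (inverse s) * exp (- inverse s)) \<longlongrightarrow> 0) (at_right 0)"
      using filterlim_compose[OF poly_times_exp_minus_tendsto_0 filterlim_inverse_at_top_right] .
    have "((\<lambda>s. flat n s / s) \<longlongrightarrow> 0) (at_right 0)"
      by (rule Lim_transform_eventually[OF r])
        (auto simp: eventually_at_filter flat_def field_simps)
    moreover have "((\<lambda>s. flat n s / s) \<longlongrightarrow> 0) (at_left 0)"
      by (rule tendsto_eventually) (auto simp: eventually_at_filter flat_def)
    ultimately have "((\<lambda>s. flat n s / s) \<longlongrightarrow> 0) (at 0)"
      by (intro filterlim_split_at)
    then show ?thesis using 2 by (simp add: has_field_derivative_iff flat_def)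
  next
    case 3
    define p where "p = flat_pol n"
    have i: "(inverse has_real_derivative - (inverse t ^ Suc (Suc 0))) (at t)"
      using 3 by (intro DERIV_inverse) simp
    have "((\<lambda>t. poly p (inverse t) * exp (- inverse t)) has_real_derivative
        poly (pderiv p) (inverse t) * - (inverse t ^ Suc (Suc 0)) * exp (- inverse t)
        + exp (- inverse t) * - (- (inverse t ^ Suc (Suc 0))) * poly p (inverse t)) (at t)"
      by (intro DERIV_mult DERIV_chain2[OF poly_DERIV i] DERIV_chain2[OF DERIV_exp DERIV_minus[OF i]])
    also have "poly (pderiv p) (inverse t) * - (inverse t ^ Suc (Suc 0)) * exp (- inverse t)
        + exp (- inverse t) * - (- (inverse t ^ Suc (Suc 0))) * poly p (inverse t) = flat (Suc n) t"
      using 3 by (simp add: flat_def flat_pol_def p_def algebra_simps)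
    finally have "((\<lambda>t. poly (flat_pol n) (inverse t) * exp (- inverse t)) has_real_derivative flat (Suc n) t) (at t)"
      by (simp add: p_def)
    then show ?thesis
      by (rule has_field_derivative_transform_within_open[of _ _ _ "{0<..}"]) (use 3 in \<open>auto simp: flat_def\<close>)
  qed
qed

lemma Ck_on_flat:
  fixes f :: "'a::real_normed_vector \<Rightarrow> real"
  assumes "open S" "Ck_on k S f"
  shows "Ck_on k S (\<lambda>x. flat 0 (f x))"
  by (rule Ck_on_compose[where H=flat, OF assms flat_has_derivative])

lemma flat_0_eq_0: "t \<le> 0 \<Longrightarrow> flat 0 t = 0" and flat_0_pos: "t > 0 \<Longrightarrow> flat 0 t > 0"
  by (auto simp: flat_def flat_pol_def)

definition step_function :: "real \<Rightarrow> real" where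
  "step_function t = flat 0 (2 - t) * inverse (flat 0 (2 - t) + flat 0 (t - 1))"

lemma step_function_eq_1: "t \<le> 1 \<Longrightarrow> step_function t = 1"
  and step_function_eq_0: "t \<ge> 2 \<Longrightarrow> step_function t = 0"
  using flat_0_pos[of "2 - t"] by (simp_all add: step_function_def flat_0_eq_0)

lemma Ck_on_step_function:
  fixes f :: "'a::real_normed_vector \<Rightarrow> real"
  assumes "open S" "Ck_on k S f"
  shows "Ck_on k S (\<lambda>x. step_function (f x))"
proof -
  note mult = bounded_bilinear.Ck_on_prod[OF bounded_bilinear_mult assms(1)]
  have m: "Ck_on k S (\<lambda>x. - 1 * f x)"
    by (intro mult Ck_on_const assms)
  have 1: "Ck_on k S (\<lambda>x. 2 + - 1 * f x)" "Ck_on k S (\<lambda>x. f x + - 1)"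
    by (intro Ck_on_add Ck_on_const m assms)+
  \<comment> \<open>The numbers 2 - t and t - 1 have sum 1, so at least one is positive and the
    denominator never vanishes.\<close>
  have "flat 0 (2 - t) + flat 0 (t - 1) > 0" for t
    using flat_0_pos[of "2 - t"] flat_0_pos[of "t - 1"] flat_0_eq_0[of "2 - t"] flat_0_eq_0[of "t - 1"]
    by (smt (verit))
  then have 2: "flat 0 (2 - t) + flat 0 (t - 1) \<noteq> 0" for t
    by (metis less_irrefl)
  have "Ck_on k S (\<lambda>x. flat 0 (2 - f x))" "Ck_on k S (\<lambda>x. flat 0 (f x - 1))"
    using Ck_on_flat[OF assms(1) 1(1)] Ck_on_flat[OF assms(1) 1(2)] by simp_all
  then show ?thesis unfolding step_function_def
    by (intro mult Ck_on_inverse Ck_on_add assms(1) 2)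
qed

text \<open>Sets of linear combinations with bounded coefficients are compact, by induction on the
  number of vectors. A ball is a closed subset of such a set: for an orthogonal spanning family,
  Cauchy-Schwarz bounds every coefficient. This gives bump functions their compact supports.\<close>

lemma compact_cball_finite_dim:
  fixes a :: "'b::real_inner"
  assumes "finite B" "span B = (UNIV :: 'b set)"
  shows "compact (cball a r)"
proof -
  obtain C :: "'b set" where C: "finite C" "span C = UNIV" "pairwise real_inner_class.orthogonal C"
    using basis_orthogonal[OF assms(1)] assms(2) by auto
  define C' where "C' = C - {0}"
  \<comment> \<open>An orthogonal family may contain 0; dropping it keeps the span and allows
    division by \<open>norm b\<close>.\<close>
  have C': "finite C'" "span C' = UNIV" "pairwise real_inner_class.orthogonal C'" "0 \<notin> C'"
    using C by (auto simp: C'_def pairwise_def)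
  define box where "box D M = {x. \<exists>c. (\<forall>b\<in>D. \<bar>c b\<bar> \<le> M) \<and> x = (\<Sum>b\<in>D. c b *\<^sub>R b)}" for D :: "'b set" and M :: real
  have box: "compact (box D M)" if "finite D" for D M
    using that
  proof (induction D rule: finite_induct)
    case empty
    then show ?case by (auto simp: box_def)
  next
    case (insert d D)
    have "box (insert d D) M = (\<lambda>(t, x). t *\<^sub>R d + x) ` ({-M..M} \<times> box D M)"
    proof (intro equalityI subsetI)
      fix x assume "x \<in> box (insert d D) M"
      then obtain c where c: "\<forall>b\<in>insert d D. \<bar>c b\<bar> \<le> M" "x = (\<Sum>b\<in>insert d D. c b *\<^sub>R b)"
        by (auto simp: box_def)
      have "(\<Sum>b\<in>D. c b *\<^sub>R b) \<in> box D M" using c(1) by (auto simp: box_def)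
      moreover have "x = c d *\<^sub>R d + (\<Sum>b\<in>D. c b *\<^sub>R b)" using c(2) insert by simp
      moreover have "c d \<in> {-M..M}" using c(1) by (auto simp: abs_le_iff)
      ultimately show "x \<in> (\<lambda>(t, x). t *\<^sub>R d + x) ` ({-M..M} \<times> box D M)"
        by (auto intro!: image_eqI[where x="(c d, \<Sum>b\<in>D. c b *\<^sub>R b)"])
    next
      fix x assume "x \<in> (\<lambda>(t, x). t *\<^sub>R d + x) ` ({-M..M} \<times> box D M)"
      then obtain t c where c: "t \<in> {-M..M}" "\<forall>b\<in>D. \<bar>c b\<bar> \<le> M" "x = t *\<^sub>R d + (\<Sum>b\<in>D. c b *\<^sub>R b)"
        by (auto simp: box_def)
      have "(\<Sum>b\<in>D. (c(d := t)) b *\<^sub>R b) = (\<Sum>b\<in>D. c b *\<^sub>R b)"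
        using insert by (intro sum.cong) auto
      then have "x = (\<Sum>b\<in>insert d D. (c(d := t)) b *\<^sub>R b)" using insert c by simp
      moreover have "\<forall>b\<in>insert d D. \<bar>(c(d := t)) b\<bar> \<le> M" using c by (auto simp: abs_le_iff)
      ultimately show "x \<in> box (insert d D) M" unfolding box_def by blast
    qed
    moreover have "compact \<dots>"
      by (intro compact_continuous_image compact_Times insert.IH)
        (auto simp: case_prod_beta intro!: continuous_intros)
    ultimately show ?case by simp
  qed
  \<comment> \<open>Each coefficient of x is at most \<open>norm x / norm b\<close> in absolute
    value. The sum of the inverse norms bounds all of them at once and needs no maximum, which would
    fail for the empty family in dimension 0.\<close>
  define m where "m = (\<Sum>b\<in>C'. inverse (norm b))"
  have "cball 0 R \<subseteq> box C' (R * m)" for R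
  proof
    fix x :: 'b assume x: "x \<in> cball 0 R"
    obtain c where c: "x = (\<Sum>b\<in>C'. c b *\<^sub>R b)"
      using span_finite[OF C'(1)] C'(2) by auto
    have "\<bar>c b\<bar> \<le> R * m" if b: "b \<in> C'" for b
    proof -
      have "x \<bullet> b = (\<Sum>b'\<in>C'. c b' * (b' \<bullet> b))" by (simp add: c inner_sum_left)
      also have "\<dots> = (\<Sum>b'\<in>C'. if b' = b then c b * (b \<bullet> b) else 0)"
        using C'(3) b by (intro sum.cong) (auto simp: pairwise_def real_inner_class.orthogonal_def)
      also have "\<dots> = c b * (b \<bullet> b)" using C'(1) b by simp
      finally have e: "\<bar>c b\<bar> * (norm b)\<^sup>2 = \<bar>x \<bullet> b\<bar>"
        by (simp add: power2_norm_eq_inner abs_mult)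
      have "norm b > 0" using b C'(4) by auto
      moreover have "(\<bar>c b\<bar> * norm b) * norm b = \<bar>x \<bullet> b\<bar>"
        unfolding e[symmetric] by (simp only: power2_eq_square mult.assoc)
      ultimately have "\<bar>c b\<bar> * norm b \<le> norm x"
        using Cauchy_Schwarz_ineq2[of x b] by (metis mult_right_le_imp_le)
      then have "\<bar>c b\<bar> \<le> norm x * inverse (norm b)"
        using \<open>norm b > 0\<close> by (simp add: field_simps)
      also have "\<dots> \<le> R * m"
      proof (rule mult_mono)
        show "inverse (norm b) \<le> m" unfolding m_def
          by (rule member_le_sum[OF b]) (use C' in auto)
      qed (use x norm_ge_zero[of x] order_trans[of 0 "norm x" R] in \<open>auto simp: dist_norm\<close>)
      finally show ?thesis .
    qed
    with c show "x \<in> box C' (R * m)" unfolding box_def by blast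
  qed
  then have *: "compact (cball (0::'b) R)" for R
    using compact_Int_closed[OF box[OF C'(1)] closed_cball, of "R * m" 0 R]
    by (simp add: inf.absorb2)
  show ?thesis using compact_translation[OF *, of a r] by simp
qed

section \<open>Smooth functions on a manifold\<close>

lemma smooth_fun_subset: "smooth_fun A U f \<Longrightarrow> W \<subseteq> U \<Longrightarrow> smooth_fun A W f"
  unfolding smooth_fun_def Cinf_on_def
  by (blast intro: Ck_on_subset)

locale manifold =
  fixes A :: "('m::{t2_space,second_countable_topology}, 'b::real_inner) chart set"
  assumes smooth_manifold: "smooth_manifold A"
begin

lemma chart_homeomorphism:
  assumes "(V, \<phi>) \<in> A"
  shows "open V" "open (\<phi> ` V)" "homeomorphism V (\<phi> ` V) \<phi> (inv_into V \<phi>)"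
  using smooth_manifold assms by (auto simp: smooth_manifold_def)

lemma chart_transition:
  "(U, \<phi>) \<in> A \<Longrightarrow> (V, \<psi>) \<in> A \<Longrightarrow> Ck_on k (\<phi> ` (U \<inter> V)) (\<psi> \<circ> inv_into U \<phi>)"
  using smooth_manifold by (fastforce simp: smooth_manifold_def Cinf_on_def)

lemma chart_at: obtains V \<phi> where "(V, \<phi>) \<in> A" "p \<in> V"
proof -
  have "p \<in> (\<Union>(U,\<phi>)\<in>A. U)" using smooth_manifold by (simp add: smooth_manifold_def)
  then show ?thesis using that by auto
qed

lemma inv_into_chart: "(V, \<phi>) \<in> A \<Longrightarrow> q \<in> V \<Longrightarrow> inv_into V \<phi> (\<phi> q) = q"
  using chart_homeomorphism(3) by (metis homeomorphism_apply1)

lemma open_chart_image: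
  assumes "(V, \<phi>) \<in> A" "open U"
  shows "open (\<phi> ` (U \<inter> V))"
proof -
  note h = chart_homeomorphism[OF assms(1)]
  have "openin (top_of_set (\<phi> ` V)) (\<phi> ` (U \<inter> V))"
    by (rule homeomorphism_imp_open_map[OF h(3)]) (use assms(2) in \<open>auto simp: openin_open\<close>)
  then show ?thesis using h(2) openin_open_trans by blast
qed

lemma smooth_fun_iff:
  "smooth_fun A U f \<longleftrightarrow> (\<forall>k V \<phi>. (V, \<phi>) \<in> A \<longrightarrow> Ck_on k (\<phi> ` (U \<inter> V)) (\<lambda>y. f (inv_into V \<phi> y)))"
  by (auto simp: smooth_fun_def Cinf_on_def o_def)

lemma smooth_fun_cong:
  assumes "open U" "smooth_fun A U f" "\<And>q. q \<in> U \<Longrightarrow> f q = g q"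
  shows "smooth_fun A U g"
  unfolding smooth_fun_iff
proof (intro allI impI)
  fix k V \<phi> assume c: "(V, \<phi>) \<in> A"
  have "Ck_on k (\<phi> ` (U \<inter> V)) (\<lambda>y. f (inv_into V \<phi> y))"
    using assms(2) c by (simp add: smooth_fun_iff)
  then show "Ck_on k (\<phi> ` (U \<inter> V)) (\<lambda>y. g (inv_into V \<phi> y))"
    by (rule Ck_on_cong[OF open_chart_image[OF c assms(1)], rotated])
      (use assms(3) inv_into_chart[OF c] in auto)
qed

lemma smooth_fun_local:
  assumes "\<And>p. p \<in> U \<Longrightarrow> \<exists>W. open W \<and> p \<in> W \<and> smooth_fun A W f"
  shows "smooth_fun A U f"
  unfolding smooth_fun_iff
proof (intro allI impI)
  fix k V \<phi> assume c: "(V, \<phi>) \<in> A"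
  show "Ck_on k (\<phi> ` (U \<inter> V)) (\<lambda>y. f (inv_into V \<phi> y))"
  proof (rule Ck_on_local)
    fix y assume "y \<in> \<phi> ` (U \<inter> V)"
    then obtain p where p: "p \<in> U" "p \<in> V" "y = \<phi> p" by auto
    obtain W where W: "open W" "p \<in> W" "smooth_fun A W f" using assms[OF p(1)] by auto
    have "Ck_on k (\<phi> ` (W \<inter> V)) (\<lambda>y. f (inv_into V \<phi> y))"
      using W(3) c by (simp add: smooth_fun_iff)
    then show "\<exists>T. open T \<and> y \<in> T \<and> Ck_on k T (\<lambda>y. f (inv_into V \<phi> y))"
      using open_chart_image[OF c W(1)] p W(2) by auto
  qed
qed

lemma smooth_fun_const: "open U \<Longrightarrow> smooth_fun A U (\<lambda>_. c)"
  by (simp add: smooth_fun_iff Ck_on_const open_chart_image)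

lemma smooth_fun_add:
  "open U \<Longrightarrow> smooth_fun A U f \<Longrightarrow> smooth_fun A U g \<Longrightarrow> smooth_fun A U (\<lambda>q. f q + g q)"
  by (simp add: smooth_fun_iff Ck_on_add open_chart_image)

lemma smooth_fun_mult:
  fixes f g :: "'m \<Rightarrow> real"
  shows "open U \<Longrightarrow> smooth_fun A U f \<Longrightarrow> smooth_fun A U g \<Longrightarrow> smooth_fun A U (\<lambda>q. f q * g q)"
  by (simp add: smooth_fun_iff bounded_bilinear.Ck_on_prod[OF bounded_bilinear_mult] open_chart_image)

lemma smooth_fun_inverse:
  fixes f :: "'m \<Rightarrow> real"
  assumes "open U" "smooth_fun A U f" "\<And>q. q \<in> U \<Longrightarrow> f q \<noteq> 0"
  shows "smooth_fun A U (\<lambda>q. inverse (f q))"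
  unfolding smooth_fun_iff
proof (intro allI impI)
  fix k V \<phi> assume c: "(V, \<phi>) \<in> A"
  show "Ck_on k (\<phi> ` (U \<inter> V)) (\<lambda>y. inverse (f (inv_into V \<phi> y)))"
    by (rule Ck_on_inverse[OF open_chart_image[OF c assms(1)]])
      (use assms(2,3) c in \<open>auto simp: smooth_fun_iff inv_into_chart\<close>)
qed

lemma smooth_fun_minus:
  fixes f :: "'m \<Rightarrow> real"
  shows "open U \<Longrightarrow> smooth_fun A U f \<Longrightarrow> smooth_fun A U (\<lambda>q. - f q)"
  using smooth_fun_mult[OF _ smooth_fun_const, of U f "- 1"] by simp

lemma smooth_fun_sum:
  assumes "open U" "\<And>i. i \<in> I \<Longrightarrow> smooth_fun A U (f i)"
  shows "smooth_fun A U (\<lambda>q. \<Sum>i\<in>I. f i q)"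
  using assms(2)
  by (induction I rule: infinite_finite_induct) (simp_all add: assms(1) smooth_fun_const smooth_fun_add)

lemma smooth_fun_prod:
  fixes f :: "'i \<Rightarrow> 'm \<Rightarrow> real"
  assumes "open U" "\<And>i. i \<in> I \<Longrightarrow> smooth_fun A U (f i)"
  shows "smooth_fun A U (\<lambda>q. \<Prod>i\<in>I. f i q)"
  using assms(2)
  by (induction I rule: infinite_finite_induct) (simp_all add: assms(1) smooth_fun_const smooth_fun_mult)

text \<open>K is the preimage of a closed ball in a chart, hence compact, hence closed because the
  manifold is Hausdorff. Therefore the chart domain and the complement of K form an open cover, and
  the function is smooth on both.\<close>

lemma bump_function:
  assumes "open W" "p \<in> W"
  obtains f :: "'m \<Rightarrow> real" and K where "smooth_fun A UNIV f" "closed K" "K \<subseteq> W"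
    "\<And>q. q \<notin> K \<Longrightarrow> f q = 0" "\<forall>\<^sub>F q in nhds p. f q = 1"
proof -
  obtain V \<phi> where c: "(V, \<phi>) \<in> A" "p \<in> V" by (rule chart_at)
  note h = chart_homeomorphism[OF c(1)]
  obtain r where r: "r > 0" "cball (\<phi> p) r \<subseteq> \<phi> ` (W \<inter> V)"
    using bspec[OF iffD1[OF open_contains_cball open_chart_image[OF c(1) assms(1)]], of "\<phi> p"] assms(2) c(2)
    by blast
  \<comment> \<open>The squared distance is smooth also at the centre. The factor makes g at most
    1/2 within radius r/2, where the cutoff is 1, and at least 2 from radius r on, where it is
    0.\<close>
  define g where "g y = 2 / r\<^sup>2 * ((y - \<phi> p) \<bullet> (y - \<phi> p))" for y
  define f where "f q = (if q \<in> V then step_function (g (\<phi> q)) else 0)" for q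
  define K where "K = inv_into V \<phi> ` cball (\<phi> p) r"
  have KV: "K \<subseteq> W \<inter> V"
  proof
    fix q assume "q \<in> K"
    then obtain y where y: "y \<in> cball (\<phi> p) r" "q = inv_into V \<phi> y" by (auto simp: K_def)
    then obtain q' where "q' \<in> W \<inter> V" "y = \<phi> q'" using r(2) by auto
    then show "q \<in> W \<inter> V" using y inv_into_chart[OF c(1)] by auto
  qed
  obtain B :: "'b set" where "finite B" "span B = UNIV"
    using smooth_manifold by (auto simp: smooth_manifold_def)
  then have "compact (cball (\<phi> p) r)" by (rule compact_cball_finite_dim)
  then have "compact K" unfolding K_def
    by (rule compact_continuous_image[rotated])
      (rule continuous_on_subset[OF homeomorphism_cont2[OF h(3)]], use r(2) in auto)
  then have K: "closed K" by (rule compact_imp_closed)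
  have f0: "f q = 0" if q: "q \<notin> K" for q
  proof (cases "q \<in> V")
    case True
    have "\<phi> q \<notin> cball (\<phi> p) r"
      using q inv_into_chart[OF c(1) True] by (force simp: K_def)
    then have "r\<^sup>2 \<le> (norm (\<phi> q - \<phi> p))\<^sup>2"
      using r(1) by (intro power_mono) (auto simp: dist_norm norm_minus_commute)
    then have "g (\<phi> q) \<ge> 2"
      using r(1) by (simp add: g_def power2_norm_eq_inner field_simps)
    then show ?thesis by (simp add: f_def step_function_eq_0)
  qed (simp add: f_def)
  have "\<forall>\<^sub>F q in nhds p. f q = 1"
  proof -
    have "open (\<phi> ` V \<inter> ball (\<phi> p) (r / 2))" using h(2) by auto
    then have "open (V \<inter> \<phi> -` ball (\<phi> p) (r / 2))"
      using continuous_open_preimage[OF homeomorphism_cont1[OF h(3)] h(1) open_ball] by simp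
    moreover have "p \<in> V \<inter> \<phi> -` ball (\<phi> p) (r / 2)" using c r(1) by auto
    moreover have "f q = 1" if q: "q \<in> V \<inter> \<phi> -` ball (\<phi> p) (r / 2)" for q
    proof -
      have "(norm (\<phi> q - \<phi> p))\<^sup>2 \<le> (r / 2)\<^sup>2"
        using q r(1) by (intro power_mono) (auto simp: dist_norm norm_minus_commute)
      then have "(\<phi> q - \<phi> p) \<bullet> (\<phi> q - \<phi> p) \<le> r\<^sup>2 / 4"
        by (simp add: power2_norm_eq_inner power_divide)
      then have "2 / r\<^sup>2 * ((\<phi> q - \<phi> p) \<bullet> (\<phi> q - \<phi> p)) \<le> 2 / r\<^sup>2 * (r\<^sup>2 / 4)"
        by (rule mult_left_mono) simp
      also have "\<dots> \<le> 1" using r(1) by simp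
      finally show ?thesis using q by (simp add: f_def g_def step_function_eq_1)
    qed
    ultimately show ?thesis unfolding eventually_nhds by blast
  qed
  moreover have "smooth_fun A UNIV f"
  proof (rule smooth_fun_local)
    fix q
    have "smooth_fun A V f"
      unfolding smooth_fun_iff
    proof (intro allI impI)
      fix k V' \<psi> assume c': "(V', \<psi>) \<in> A"
      have o: "open (\<psi> ` (V \<inter> V'))" by (rule open_chart_image[OF c' h(1)])
      have t: "Ck_on k (\<psi> ` (V \<inter> V')) (\<lambda>y. \<phi> (inv_into V' \<psi> y) + - \<phi> p)"
        using chart_transition[OF c' c(1), of k]
        by (intro Ck_on_add Ck_on_const o) (simp_all add: o_def Int_commute)
      have "Ck_on k (\<psi> ` (V \<inter> V')) (\<lambda>y. 2 / r\<^sup>2 *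
          ((\<phi> (inv_into V' \<psi> y) + - \<phi> p) \<bullet> (\<phi> (inv_into V' \<psi> y) + - \<phi> p)))"
        by (rule bounded_bilinear.Ck_on_prod[OF bounded_bilinear_mult o Ck_on_const[OF o]
              bounded_bilinear.Ck_on_prod[OF bounded_bilinear_inner o t t]])
      then have "Ck_on k (\<psi> ` (V \<inter> V')) (\<lambda>y. step_function (g (\<phi> (inv_into V' \<psi> y))))"
        using Ck_on_step_function[OF o] by (simp add: g_def)
      then show "Ck_on k (\<psi> ` (V \<inter> V')) (\<lambda>y. f (inv_into V' \<psi> y))"
        by (rule Ck_on_cong[OF o, rotated]) (auto simp: f_def inv_into_chart[OF c'])
    qed
    moreover have "smooth_fun A (- K) f"
      by (rule smooth_fun_cong[OF _ smooth_fun_const]) (use K f0 in auto)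
    ultimately show "\<exists>W. open W \<and> q \<in> W \<and> smooth_fun A W f"
      using KV h(1) K by (cases "q \<in> V") (auto simp: closed_def)
  qed
  ultimately show ?thesis using that[of f K] K KV f0 by auto
qed

lemma smooth_fun_extend_by_zero:
  assumes "smooth_fun A W f" "open W" "closed K" "K \<subseteq> W" "\<And>q. q \<notin> K \<Longrightarrow> f q = 0"
  shows "smooth_fun A UNIV f"
proof (rule smooth_fun_local)
  fix q
  have "smooth_fun A (- K) f"
    by (rule smooth_fun_cong[OF _ smooth_fun_const]) (use assms in auto)
  then show "\<exists>W. open W \<and> q \<in> W \<and> smooth_fun A W f"
    using assms by (cases "q \<in> W") (auto simp: closed_def)
qed

end

section \<open>Inverses of smooth matrices\<close>

context manifold
begin

lemma smooth_fun_det: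
  fixes C :: "'m \<Rightarrow> real Matrix.mat"
  assumes "open U" "\<And>q. C q \<in> carrier_mat n n"
    "\<And>i j. i < n \<Longrightarrow> j < n \<Longrightarrow> smooth_fun A U (\<lambda>q. C q $$ (i, j))"
  shows "smooth_fun A U (\<lambda>q. Determinant.det (C q))"
proof -
  have "smooth_fun A U (\<lambda>q. \<Sum>p | p permutes {0..<n}. signof p * (\<Prod>i = 0..<n. C q $$ (i, p i)))"
    using assms(1)
    by (intro smooth_fun_sum smooth_fun_mult smooth_fun_const smooth_fun_prod assms(3))
      (auto dest: permutes_in_image)
  then show ?thesis by (simp add: det_def'[OF assms(2)])
qed

text \<open>Multiplying C D = 1 by the adjugate gives adj(C) = det(C) D, so every entry of D is a
  cofactor of C divided by the determinant, and both of these are polynomials in the smooth entries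
  of C.\<close>

lemma smooth_fun_inverse_matrix:
  fixes n :: nat
  assumes "open U" and c: "\<And>a b. a < n \<Longrightarrow> b < n \<Longrightarrow> smooth_fun A U (c a b)"
    and cd: "\<And>q a e. q \<in> U \<Longrightarrow> a < n \<Longrightarrow> e < n \<Longrightarrow>
      (\<Sum>b<n. c a b q * d b e q) = (if a = e then 1 else 0 :: real)"
    and "a < n" "b < n"
  shows "smooth_fun A U (d a b)"
proof -
  define C where "C q = Matrix.mat n n (\<lambda>(a, b). c a b q)" for q
  define D where "D q = Matrix.mat n n (\<lambda>(a, b). d a b q)" for q
  have dim: "C q \<in> carrier_mat n n" "D q \<in> carrier_mat n n" for q
    by (simp_all add: C_def D_def)
  have CD: "C q * D q = 1\<^sub>m n" if "q \<in> U" for q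
    by (rule eq_matI)
      (use cd[OF that] in \<open>auto simp: C_def D_def times_mat_def scalar_prod_def atLeast0LessThan\<close>)
  have det: "Determinant.det (C q) \<noteq> 0" if "q \<in> U" for q
    using det_mult[OF dim(1)[of q] dim(2)[of q]] CD[OF that] by auto
  have "smooth_fun A U (\<lambda>q. cofactor (C q) b a)"
    unfolding cofactor_def
  proof (intro smooth_fun_mult smooth_fun_const assms(1) smooth_fun_det[where n="n - 1"])
    fix i j assume ij: "i < n - 1" "j < n - 1"
    \<comment> \<open>Row b and column a are removed (the adjugate transposes the indices), so an
      index at or beyond the gap moves up by one.\<close>
    then have "mat_delete (C q) b a $$ (i, j) =
        c (if i < b then i else Suc i) (if j < a then j else Suc j) q" for q
      using assms(4,5) by (auto simp: mat_delete_def C_def)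
    then show "smooth_fun A U (\<lambda>q. mat_delete (C q) b a $$ (i, j))"
      using ij assms(4,5) by (auto intro!: c)
  qed (use mat_delete_carrier[OF dim(1)] in auto)
  moreover have "smooth_fun A U (\<lambda>q. inverse (Determinant.det (C q)))"
    by (intro smooth_fun_inverse smooth_fun_det[where n=n] assms(1) det dim) (simp_all add: C_def c)
  ultimately have "smooth_fun A U (\<lambda>q. inverse (Determinant.det (C q)) * cofactor (C q) b a)"
    by (intro smooth_fun_mult assms(1))
  then show ?thesis
  proof (rule smooth_fun_cong[OF assms(1)])
    fix q assume q: "q \<in> U"
    note adj = adj_mat[OF dim(1)[of q]]
    have "adj_mat (C q) = adj_mat (C q) * (C q * D q)" using adj(1) by (simp add: CD[OF q])
    also have "\<dots> = (adj_mat (C q) * C q) * D q" using adj(1) dim by (simp add: assoc_mult_mat[of _ n n _ n _ n])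
    also have "\<dots> = Determinant.det (C q) \<cdot>\<^sub>m D q"
      by (simp add: adj(3) mult_smult_assoc_mat[OF one_carrier_mat dim(2)] left_mult_one_mat[OF dim(2)])
    finally have "adj_mat (C q) $$ (a, b) = (Determinant.det (C q) \<cdot>\<^sub>m D q) $$ (a, b)" by simp
    then have "cofactor (C q) b a = Determinant.det (C q) * d a b q"
      using assms(4,5) by (simp add: adj_mat_def C_def D_def)
    then show "inverse (Determinant.det (C q)) * cofactor (C q) b a = d a b q"
      using det[OF q] by simp
  qed
qed

end

section \<open>Frames and sections of a vector bundle\<close>

context
  fixes E :: "('m::{t2_space,second_countable_topology}, 'b::real_inner, 'v::real_vector, 'z) vbundle_scheme"
    and U X p
  assumes basis: "pointwise_basis E U X" and p: "p \<in> U"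
begin

lemma frame_facts:
  "inj_on (\<lambda>a. X a p) {..<rk E}" "independent ((\<lambda>a. X a p) ` {..<rk E})"
  "span ((\<lambda>a. X a p) ` {..<rk E}) = fibre E p"
  using basis p by (auto simp: pointwise_basis_def)

lemma frame_in_fibre: "a < rk E \<Longrightarrow> X a p \<in> fibre E p"
  using frame_facts(3) by (auto intro: span_base)

lemma coframe_expansion:
  assumes "x \<in> fibre E p"
  shows "(\<Sum>a<rk E. dual_coframe E X a p x *\<^sub>R X a p) = x"
proof -
  have "(\<Sum>b\<in>(\<lambda>a. X a p) ` {..<rk E}. representation ((\<lambda>a. X a p) ` {..<rk E}) x b *\<^sub>R b) = x"
    by (rule real_vector.sum_representation_eq) (use frame_facts assms in auto)
  then show ?thesis
    by (simp add: sum.reindex[OF frame_facts(1)] dual_coframe_def)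
qed

lemma coframe_add:
  "x \<in> fibre E p \<Longrightarrow> y \<in> fibre E p \<Longrightarrow>
    dual_coframe E X a p (x + y) = dual_coframe E X a p x + dual_coframe E X a p y"
  using frame_facts by (simp add: dual_coframe_def real_vector.representation_add)

lemma coframe_diff:
  "x \<in> fibre E p \<Longrightarrow> y \<in> fibre E p \<Longrightarrow>
    dual_coframe E X a p (x - y) = dual_coframe E X a p x - dual_coframe E X a p y"
  using frame_facts by (simp add: dual_coframe_def real_vector.representation_diff)

lemma coframe_scale:
  "x \<in> fibre E p \<Longrightarrow> dual_coframe E X a p (c *\<^sub>R x) = c * dual_coframe E X a p x"
  using frame_facts by (simp add: dual_coframe_def real_vector.representation_scale)

lemma coframe_sum:
  "(\<And>i. i \<in> I \<Longrightarrow> f i \<in> fibre E p) \<Longrightarrow>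
    dual_coframe E X a p (\<Sum>i\<in>I. f i) = (\<Sum>i\<in>I. dual_coframe E X a p (f i))"
  using frame_facts by (simp add: dual_coframe_def real_vector.representation_sum)

lemma coframe_outside_fibre: "x \<notin> fibre E p \<Longrightarrow> dual_coframe E X a p x = 0"
  using frame_facts by (simp add: dual_coframe_def real_vector.representation_def)

lemma coframe_frame:
  "a < rk E \<Longrightarrow> b < rk E \<Longrightarrow> dual_coframe E X a p (X b p) = (if a = b then 1 else 0)"
  using frame_facts by (auto simp: dual_coframe_def real_vector.representation_basis inj_on_def)

lemma coframe_combination:
  assumes "a < rk E"
  shows "dual_coframe E X a p (\<Sum>b<rk E. c b *\<^sub>R X b p) = c a"
proof -
  \<comment> \<open>Only a pointwise basis is given here, so the fibre is seen to be a subspace as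
    the span of that basis.\<close>
  have s: "subspace (fibre E p)" using frame_facts(3) by (metis subspace_span)
  have "dual_coframe E X a p (\<Sum>b<rk E. c b *\<^sub>R X b p) = (\<Sum>b<rk E. c b * dual_coframe E X a p (X b p))"
    by (subst coframe_sum) (auto simp: frame_in_fibre coframe_scale subspace_scale[OF s])
  also have "\<dots> = (\<Sum>b<rk E. if b = a then c b else 0)"
    using assms by (intro sum.cong) (auto simp: coframe_frame)
  finally show ?thesis using assms by simp
qed

end

locale smooth_bundle =
  fixes E :: "('m::{t2_space,second_countable_topology}, 'b::real_inner, 'v::real_vector, 'z) vbundle_scheme"
  assumes vector_bundle: "vector_bundle E"
begin

sublocale manifold "charts E"
  using vector_bundle by unfold_locales (simp add: vector_bundle_def)

lemma subspace_fibre: "subspace (fibre E p)"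
  using vector_bundle by (simp add: vector_bundle_def)

lemma triv_open: "(V, Y) \<in> trivs E \<Longrightarrow> open V"
  and triv_basis: "(V, Y) \<in> trivs E \<Longrightarrow> pointwise_basis E V Y"
  using vector_bundle by (auto simp: vector_bundle_def)

lemma triv_at: obtains V Y where "(V, Y) \<in> trivs E" "p \<in> V"
proof -
  have "p \<in> (\<Union>(U,X)\<in>trivs E. U)" using vector_bundle by (simp add: vector_bundle_def)
  then show ?thesis using that by auto
qed

text \<open>Coordinates in a basis are unique, so the coefficients whose existence
  \<open>local_section\<close> asserts must be the values of the dual coframe. Closure properties
  then reduce to closure properties of smooth functions.\<close>

lemma local_section_iff:
  assumes "open U"
  shows "local_section E U s \<longleftrightarrow> (\<forall>p\<in>U. s p \<in> fibre E p) \<and>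
    (\<forall>(V,Y)\<in>trivs E. \<forall>a<rk E. smooth_fun (charts E) (U \<inter> V) (\<lambda>q. dual_coframe E Y a q (s q)))"
    (is "?L \<longleftrightarrow> ?R")
proof
  assume L: ?L
  have "smooth_fun (charts E) (U \<inter> V) (\<lambda>q. dual_coframe E Y a q (s q))"
    if V: "(V, Y) \<in> trivs E" and a: "a < rk E" for V Y a
  proof -
    obtain c where c: "\<forall>a<rk E. smooth_fun (charts E) (U \<inter> V) (c a)"
      "\<forall>p\<in>U \<inter> V. s p = (\<Sum>a<rk E. c a p *\<^sub>R Y a p)"
      using L V unfolding local_section_def by blast
    have "smooth_fun (charts E) (U \<inter> V) (c a)" using c(1) a by simp
    then show ?thesis
      by (rule smooth_fun_cong[rotated])
        (use c(2) a V assms in \<open>auto simp: triv_open coframe_combination[OF triv_basis[OF V]]\<close>)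
  qed
  then show ?R using L by (auto simp: local_section_def)
next
  assume R: ?R
  have "\<exists>c. (\<forall>a<rk E. smooth_fun (charts E) (U \<inter> V) (c a)) \<and>
      (\<forall>p\<in>U \<inter> V. s p = (\<Sum>a<rk E. c a p *\<^sub>R Y a p))" if V: "(V, Y) \<in> trivs E" for V Y
    by (rule exI[of _ "\<lambda>a q. dual_coframe E Y a q (s q)"])
      (use R V coframe_expansion[OF triv_basis[OF V]] in auto)
  then show ?L using R unfolding local_section_def by auto
qed

lemma local_section_fibre: "local_section E U s \<Longrightarrow> p \<in> U \<Longrightarrow> s p \<in> fibre E p"
  by (simp add: local_section_def)

lemma section_fibre: "s \<in> sections E \<Longrightarrow> s p \<in> fibre E p"
  by (simp add: sections_def local_section_def)

lemma local_section_subset: "local_section E U s \<Longrightarrow> W \<subseteq> U \<Longrightarrow> open U \<Longrightarrow> open W \<Longrightarrow> local_section E W s"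
  by (fastforce simp: local_section_iff elim!: smooth_fun_subset)

lemma section_imp_local_section: "s \<in> sections E \<Longrightarrow> open U \<Longrightarrow> local_section E U s"
  using local_section_subset[of UNIV s U] by (simp add: sections_def)

lemma local_section_cong:
  assumes "local_section E U s" "\<And>q. q \<in> U \<Longrightarrow> s q = t q"
  shows "local_section E U t"
  using assms unfolding local_section_def by (simp split: prod.splits)

lemma local_section_local:
  assumes "open U" "\<And>p. p \<in> U \<Longrightarrow> \<exists>W. open W \<and> p \<in> W \<and> local_section E W s"
  shows "local_section E U s"
  unfolding local_section_iff[OF assms(1)]
proof (intro conjI ballI, goal_cases)
  case (1 p)
  then show ?case using assms(2) local_section_fibre by blast
next
  case (2 VY)
  obtain V Y where VY: "VY = (V, Y)" by fastforce
  have "smooth_fun (charts E) (U \<inter> V) (\<lambda>q. dual_coframe E Y a q (s q))" if "a < rk E" for a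
  proof (rule smooth_fun_local)
    fix p assume p: "p \<in> U \<inter> V"
    then obtain W where W: "open W" "p \<in> W" "local_section E W s" using assms(2) by blast
    then have "smooth_fun (charts E) (W \<inter> V) (\<lambda>q. dual_coframe E Y a q (s q))"
      using 2 VY that by (auto simp: local_section_iff)
    then show "\<exists>W. open W \<and> p \<in> W \<and> smooth_fun (charts E) W (\<lambda>q. dual_coframe E Y a q (s q))"
      using p W triv_open 2 VY by (intro exI[of _ "W \<inter> V"]) auto
  qed
  then show ?case using VY by simp
qed

lemma local_section_zero: "open U \<Longrightarrow> local_section E U (\<lambda>_. 0)"
  by (auto simp: local_section_iff subspace_0[OF subspace_fibre] dual_coframe_def
      real_vector.representation_zero smooth_fun_const open_Int triv_open)

lemma local_section_add:
  assumes "open U" "local_section E U s" "local_section E U t"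
  shows "local_section E U (\<lambda>q. s q + t q)"
proof -
  have "smooth_fun (charts E) (U \<inter> V) (\<lambda>q. dual_coframe E Y a q (s q + t q))"
    if V: "(V, Y) \<in> trivs E" and a: "a < rk E" for V Y a
  proof (rule smooth_fun_cong)
    show "open (U \<inter> V)" using assms(1) V triv_open by auto
    then show "smooth_fun (charts E) (U \<inter> V) (\<lambda>q. dual_coframe E Y a q (s q) + dual_coframe E Y a q (t q))"
      using assms V a by (intro smooth_fun_add) (auto simp: local_section_iff)
  qed (use assms in \<open>auto simp: coframe_add[OF triv_basis[OF V]] local_section_fibre\<close>)
  then show ?thesis
    using assms by (auto simp: local_section_iff subspace_add[OF subspace_fibre])
qed

lemma local_section_scaleR:
  assumes "open U" "smooth_fun (charts E) U f" "local_section E U s"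
  shows "local_section E U (\<lambda>q. f q *\<^sub>R s q)"
proof -
  have "smooth_fun (charts E) (U \<inter> V) (\<lambda>q. dual_coframe E Y a q (f q *\<^sub>R s q))"
    if V: "(V, Y) \<in> trivs E" and a: "a < rk E" for V Y a
  proof (rule smooth_fun_cong)
    show "open (U \<inter> V)" using assms(1) V triv_open by auto
    then show "smooth_fun (charts E) (U \<inter> V) (\<lambda>q. f q * dual_coframe E Y a q (s q))"
      using assms V a smooth_fun_subset[OF assms(2), of "U \<inter> V"]
      by (intro smooth_fun_mult) (auto simp: local_section_iff)
  qed (use assms in \<open>auto simp: coframe_scale[OF triv_basis[OF V]] local_section_fibre\<close>)
  then show ?thesis
    using assms by (auto simp: local_section_iff subspace_scale[OF subspace_fibre])
qed

lemma local_section_sum: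
  assumes "open U" "\<And>i. i \<in> I \<Longrightarrow> local_section E U (s i)"
  shows "local_section E U (\<lambda>q. \<Sum>i\<in>I. s i q)"
  using assms(2)
  by (induction I rule: infinite_finite_induct) (simp_all add: assms(1) local_section_zero local_section_add)

lemma local_section_diff:
  assumes "open U" "local_section E U s" "local_section E U t"
  shows "local_section E U (\<lambda>q. s q - t q)"
  using local_section_add[OF assms(1,2) local_section_scaleR[OF assms(1) smooth_fun_const assms(3)], of "- 1"]
    assms(1) by simp

section \<open>From trivializing frames to arbitrary local frames\<close>

lemma local_frame_triv:
  assumes "(V, Y) \<in> trivs E"
  shows "local_frame E V Y"
proof -
  have "local_section E V (Y a)" if a: "a < rk E" for a
    unfolding local_section_def
  proof (intro conjI ballI, goal_cases)
    case (1 p)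
    then show ?case using frame_in_fibre[OF triv_basis[OF assms] _ a] by blast
  next
    case (2 WZ)
    obtain W Z where WZ: "WZ = (W, Z)" by fastforce
    have "\<exists>g. (\<forall>a<rk E. \<forall>b<rk E. smooth_fun (charts E) (W \<inter> V) (g a b)) \<and>
        (\<forall>p\<in>W \<inter> V. \<forall>b<rk E. Y b p = (\<Sum>a<rk E. g a b p *\<^sub>R Z a p))"
      using vector_bundle 2 assms unfolding vector_bundle_def WZ by fast
    then obtain g where "\<And>a b. a<rk E \<Longrightarrow> b<rk E \<Longrightarrow> smooth_fun (charts E) (W \<inter> V) (g a b)"
        "\<And>p b. p\<in>W \<inter> V \<Longrightarrow> b<rk E \<Longrightarrow> Y b p = (\<Sum>a<rk E. g a b p *\<^sub>R Z a p)"
      by blast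
    then show ?case using a unfolding WZ
      \<comment> \<open>The components of \<open>Y a\<close> in the frame \<open>Z\<close> form
        column a of the transition matrix.\<close>
      by (auto intro!: exI[of _ "\<lambda>b. g b a"] simp: Int_commute)
  qed
  then show ?thesis using assms triv_basis triv_open by (simp add: local_frame_def)
qed

lemma local_frame_subset:
  "local_frame E U X \<Longrightarrow> W \<subseteq> U \<Longrightarrow> open W \<Longrightarrow> local_frame E W X"
  unfolding local_frame_def pointwise_basis_def by (blast intro: local_section_subset)

text \<open>Smoothness of a section is tested in trivializing frames Y only. The components of X in
  Y form a smooth matrix; its pointwise inverse holds the components of Y in X, so the smooth
  inverse matrix converts components in Y into components in X.\<close>

lemma smooth_coframe_component:
  assumes X: "local_frame E U X" and s: "local_section E U s" and a: "a < rk E"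
  shows "smooth_fun (charts E) U (\<lambda>q. dual_coframe E X a q (s q))"
proof (rule smooth_fun_local)
  fix p assume p: "p \<in> U"
  obtain V Y where V: "(V, Y) \<in> trivs E" "p \<in> V" by (rule triv_at)
  define W where "W = U \<inter> V"
  have oU: "open U" and bX: "pointwise_basis E U X" using X by (auto simp: local_frame_def)
  have oW: "open W" using oU V triv_open by (auto simp: W_def)
  note bY = triv_basis[OF V(1)]
  let ?c = "\<lambda>b e q. dual_coframe E Y b q (X e q)" and ?d = "\<lambda>e b q. dual_coframe E X e q (Y b q)"
  have c: "smooth_fun (charts E) W (?c b e)" if "b < rk E" "e < rk E" for b e
  proof -
    have "local_section E U (X e)" using X that by (simp add: local_frame_def)
    then show ?thesis using V(1) that(1) oU by (auto simp: local_section_iff W_def)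
  qed
  have dX: "dual_coframe E X e q x = (\<Sum>b<rk E. ?d e b q * dual_coframe E Y b q x)"
    if "q \<in> W" "x \<in> fibre E q" for e q x
  proof -
    have q: "q \<in> U" "q \<in> V" using that by (auto simp: W_def)
    have f: "Y b q \<in> fibre E q" if "b < rk E" for b using frame_in_fibre[OF bY q(2) that] .
    have "dual_coframe E X e q x = dual_coframe E X e q (\<Sum>b<rk E. dual_coframe E Y b q x *\<^sub>R Y b q)"
      by (simp add: coframe_expansion[OF bY q(2) that(2)])
    also have "\<dots> = (\<Sum>b<rk E. ?d e b q * dual_coframe E Y b q x)"
      by (subst coframe_sum[OF bX q(1)])
        (auto simp: f subspace_scale[OF subspace_fibre] coframe_scale[OF bX q(1)] mult.commute)
    finally show ?thesis .
  qed
  have dY: "dual_coframe E Y e q x = (\<Sum>b<rk E. ?c e b q * dual_coframe E X b q x)"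
    if "q \<in> W" "x \<in> fibre E q" for e q x
  proof -
    have q: "q \<in> U" "q \<in> V" using that by (auto simp: W_def)
    have f: "X b q \<in> fibre E q" if "b < rk E" for b using frame_in_fibre[OF bX q(1) that] .
    have "dual_coframe E Y e q x = dual_coframe E Y e q (\<Sum>b<rk E. dual_coframe E X b q x *\<^sub>R X b q)"
      by (simp add: coframe_expansion[OF bX q(1) that(2)])
    also have "\<dots> = (\<Sum>b<rk E. ?c e b q * dual_coframe E X b q x)"
      by (subst coframe_sum[OF bY q(2)])
        (auto simp: f subspace_scale[OF subspace_fibre] coframe_scale[OF bY q(2)] mult.commute)
    finally show ?thesis .
  qed
  have inv: "(\<Sum>b<rk E. ?c i b q * ?d b j q) = (if i = j then 1 else 0)"
    if "q \<in> W" "i < rk E" "j < rk E" for q i j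
    using dY[OF that(1) frame_in_fibre[OF bY _ that(3)], of i] that coframe_frame[OF bY, of q i j]
    by (simp add: W_def)
  have d: "smooth_fun (charts E) W (?d e b)" if "e < rk E" "b < rk E" for e b
    by (rule smooth_fun_inverse_matrix[where c="?c" and n="rk E", OF oW c inv]) (use that in auto)
  have "smooth_fun (charts E) W (\<lambda>q. \<Sum>b<rk E. ?d a b q * dual_coframe E Y b q (s q))"
    using s V oU by (intro smooth_fun_sum smooth_fun_mult oW d a) (auto simp: local_section_iff W_def)
  then have "smooth_fun (charts E) W (\<lambda>q. dual_coframe E X a q (s q))"
    by (rule smooth_fun_cong[OF oW])
      (use dX s in \<open>auto simp: W_def local_section_fibre\<close>)
  then show "\<exists>W. open W \<and> p \<in> W \<and> smooth_fun (charts E) W (\<lambda>q. dual_coframe E X a q (s q))"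
    using oW p V by (auto simp: W_def)
qed

subsection \<open>Extension of germs\<close>

lemma bump_times_section:
  assumes "smooth_fun (charts E) UNIV f" "closed K" "K \<subseteq> W" "\<And>q. q \<notin> K \<Longrightarrow> f q = 0"
    "open W" "local_section E W s"
  shows "(\<lambda>q. f q *\<^sub>R s q) \<in> sections E"
  unfolding sections_def
proof (intro CollectI local_section_local[OF open_UNIV])
  fix p
  have "local_section E W (\<lambda>q. f q *\<^sub>R s q)"
    using assms smooth_fun_subset[OF assms(1)] by (intro local_section_scaleR) auto
  moreover have "local_section E (- K) (\<lambda>q. f q *\<^sub>R s q)"
    by (rule local_section_cong[OF local_section_zero]) (use assms in auto)
  ultimately show "\<exists>W. open W \<and> p \<in> W \<and> local_section E W (\<lambda>q. f q *\<^sub>R s q)"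
    using assms by (cases "p \<in> W") (auto simp: closed_def)
qed

lemma bump_times_coframe:
  assumes "smooth_fun (charts E) UNIV f" "closed K" "K \<subseteq> U" "\<And>q. q \<notin> K \<Longrightarrow> f q = 0"
    "local_frame E U X" "a < rk E"
  shows "(\<lambda>q x. f q * dual_coframe E X a q x) \<in> one_forms E"
proof -
  \<comment> \<open>Nothing is known about X outside U. There the conditions on a one-form hold
    because the factor f vanishes.\<close>
  have f0: "f q = 0" if "q \<notin> U" for q using assms(3,4) that by auto
  show ?thesis unfolding one_forms_def
  proof (intro CollectI conjI allI ballI impI, goal_cases)
    case (1 p x y)
    show ?case
    proof (cases "p \<in> U")
      case True
      then show ?thesis
        using assms(5) 1 coframe_add[of E U X p x y a] by (simp add: local_frame_def distrib_left)
    qed (simp add: f0)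
  next
    case (2 p c x)
    show ?case
    proof (cases "p \<in> U")
      case True
      then show ?thesis
        using assms(5) 2 coframe_scale[of E U X p x a c] by (simp add: local_frame_def)
    qed (simp add: f0)
  next
    case (3 p x)
    show ?case
    proof (cases "p \<in> U")
      case True
      then show ?thesis
        using assms(5) 3 coframe_outside_fibre[of E U X p x a] by (simp add: local_frame_def)
    qed (simp add: f0)
  next
    case (4 VY)
    obtain V Y where VY: "VY = (V, Y)" by fastforce
    have V: "local_frame E V Y" using 4 VY local_frame_triv by simp
    have "smooth_fun (charts E) V (\<lambda>q. f q * dual_coframe E X a q (Y b q))" if b: "b < rk E" for b
    proof (rule smooth_fun_local)
      fix p assume p: "p \<in> V"
      have o: "open (U \<inter> V)" using V assms(5) by (auto simp: local_frame_def)
      have "local_section E (U \<inter> V) (Y b)"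
        using V b o by (auto simp: local_frame_def intro: local_section_subset)
      then have "smooth_fun (charts E) (U \<inter> V) (\<lambda>q. f q * dual_coframe E X a q (Y b q))"
        using smooth_fun_subset[OF assms(1)] assms(6)
        by (intro smooth_fun_mult smooth_coframe_component[OF local_frame_subset[OF assms(5)]] o) auto
      moreover have "smooth_fun (charts E) (- K) (\<lambda>q. f q * dual_coframe E X a q (Y b q))"
        by (rule smooth_fun_cong[OF _ smooth_fun_const[of _ 0]]) (use assms in auto)
      ultimately show "\<exists>W. open W \<and> p \<in> W \<and> smooth_fun (charts E) W (\<lambda>q. f q * dual_coframe E X a q (Y b q))"
        using p o assms(2,3) by (cases "p \<in> U") (auto simp: closed_def)
    qed
    then show ?case using VY by simp
  qed
qed

lemma section_extension:
  assumes "open W" "p \<in> W" "local_section E W s"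
  obtains t where "t \<in> sections E" "\<forall>\<^sub>F q in nhds p. t q = s q"
proof -
  obtain f :: "'m \<Rightarrow> real" and K where f: "smooth_fun (charts E) UNIV f" "closed K" "K \<subseteq> W"
    "\<And>q. q \<notin> K \<Longrightarrow> f q = 0" "\<forall>\<^sub>F q in nhds p. f q = 1"
    using bump_function[OF assms(1,2)] by metis
  show ?thesis
    by (rule that[OF bump_times_section[OF f(1-4) assms(1,3)]])
      (use f(5) in \<open>auto elim: eventually_mono\<close>)
qed

text \<open>The choice in \<open>germ_ext\<close> is meaningful only where some global extension
  exists; a bump function provides one for the germ of any local section.\<close>

lemma germ_ext:
  assumes "open W" "p \<in> W" "local_section E W s"
  shows "germ_ext E p s \<in> sections E" "\<forall>\<^sub>F q in nhds p. germ_ext E p s q = s q"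
proof -
  have "\<exists>t. t \<in> sections E \<and> (\<forall>\<^sub>F q in nhds p. t q = s q)"
    using section_extension[OF assms] by metis
  from someI_ex[OF this] show "germ_ext E p s \<in> sections E" "\<forall>\<^sub>F q in nhds p. germ_ext E p s q = s q"
    by (auto simp: germ_ext_def)
qed

lemma germ_ext_form:
  assumes "local_frame E U X" "p \<in> U" "a < rk E"
  shows "germ_ext_form E p (dual_coframe E X a) \<in> one_forms E"
    "\<forall>\<^sub>F q in nhds p. germ_ext_form E p (dual_coframe E X a) q = dual_coframe E X a q"
proof -
  have "open U" using assms(1) by (simp add: local_frame_def)
  then obtain f :: "'m \<Rightarrow> real" and K where f: "smooth_fun (charts E) UNIV f" "closed K" "K \<subseteq> U"
    "\<And>q. q \<notin> K \<Longrightarrow> f q = 0" "\<forall>\<^sub>F q in nhds p. f q = 1"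
    using bump_function[of U p] assms(2) by metis
  have "\<exists>\<beta>. \<beta> \<in> one_forms E \<and> (\<forall>\<^sub>F q in nhds p. \<beta> q = dual_coframe E X a q)"
    using bump_times_coframe[OF f(1-4) assms(1,3)] f(5)
    by (intro exI[of _ "\<lambda>q x. f q * dual_coframe E X a q x"]) (auto elim: eventually_mono)
  from someI_ex[OF this] show "germ_ext_form E p (dual_coframe E X a) \<in> one_forms E"
    "\<forall>\<^sub>F q in nhds p. germ_ext_form E p (dual_coframe E X a) q = dual_coframe E X a q"
    by (auto simp: germ_ext_form_def)
qed

lemma local_frame_exists: obtains U X where "local_frame E U X" "p \<in> U"
  using triv_at local_frame_triv by metis

lemma some_frame_at: obtains U where "p \<in> U" "local_frame E U (some_frame_at E p)"
proof -
  have "\<exists>X U. p \<in> U \<and> local_frame E U X" using local_frame_exists by metis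
  from someI_ex[OF this] show ?thesis using that by (auto simp: some_frame_at_def)
qed

text \<open>Equal germs give the same predicate under the choice operator, hence literally the same
  global section.\<close>

lemma germ_ext_cong:
  assumes "\<forall>\<^sub>F q in nhds p. u q = v q"
  shows "germ_ext E p u = germ_ext E p v"
proof -
  have "(\<forall>\<^sub>F q in nhds p. s q = u q) \<longleftrightarrow> (\<forall>\<^sub>F q in nhds p. s q = v q)" for s :: "'m \<Rightarrow> 'v"
    using assms by (auto elim: eventually_elim2)
  then show ?thesis by (simp add: germ_ext_def)
qed

end

section \<open>Tensoriality\<close>

context smooth_bundle
begin

lemma section_diff: "s \<in> sections E \<Longrightarrow> t \<in> sections E \<Longrightarrow> (\<lambda>p. s p - t p) \<in> sections E"
  and section_scaleR: "f \<in> smooth_functions E \<Longrightarrow> s \<in> sections E \<Longrightarrow> (\<lambda>p. f p *\<^sub>R s p) \<in> sections E"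
  and section_zero: "(\<lambda>p. 0) \<in> sections E"
  by (simp_all add: sections_def smooth_functions_def local_section_diff
      local_section_scaleR local_section_zero)

lemma section_sum: "(\<And>i. i \<in> I \<Longrightarrow> s i \<in> sections E) \<Longrightarrow> (\<lambda>p. \<Sum>i\<in>I. s i p) \<in> sections E"
  by (simp add: sections_def local_section_sum)

lemma smooth_functions_const: "(\<lambda>p. c) \<in> smooth_functions E"
  by (simp add: smooth_functions_def smooth_fun_const)

text \<open>The complementary cutoff is 1 - f^2 because one factor f globalizes the coefficients and
  another the frame vectors.\<close>

lemma smooth_functions_one_minus_square:
  "f \<in> smooth_functions E \<Longrightarrow> (\<lambda>p. 1 - f p * f p) \<in> smooth_functions E"
  using smooth_fun_add[OF open_UNIV smooth_fun_const smooth_fun_minus[OF _ smooth_fun_mult[of UNIV f f]], of 1]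
  by (simp add: smooth_functions_def)

lemma local_section_eventually:
  assumes "open W" "\<And>p. p \<in> W \<Longrightarrow> \<exists>t\<in>sections E. \<forall>\<^sub>F q in nhds p. s q = t q"
  shows "local_section E W s"
proof (rule local_section_local[OF assms(1)])
  fix p assume "p \<in> W"
  then obtain t S where t: "t \<in> sections E" "open S" "p \<in> S" "\<forall>q\<in>S. s q = t q"
    using assms(2) unfolding eventually_nhds by metis
  have "local_section E S s"
    by (rule local_section_cong[OF section_imp_local_section[OF t(1,2)]]) (use t(4) in auto)
  then show "\<exists>W. open W \<and> p \<in> W \<and> local_section E W s" using t by blast
qed

section \<open>Tensoriality in a section argument\<close>

lemma Cinf_linearD:
  assumes "Cinf_linear E F"
  shows "s \<in> sections E \<Longrightarrow> F s \<in> sections E"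
    "s \<in> sections E \<Longrightarrow> t \<in> sections E \<Longrightarrow> F (\<lambda>p. s p + t p) = (\<lambda>p. F s p + F t p)"
    "f \<in> smooth_functions E \<Longrightarrow> s \<in> sections E \<Longrightarrow> F (\<lambda>p. f p *\<^sub>R s p) = (\<lambda>p. f p *\<^sub>R F s p)"
  using assms by (simp_all add: Cinf_linear_def)

lemma Cinf_linear_zero: "Cinf_linear E F \<Longrightarrow> F (\<lambda>p. 0) = (\<lambda>p. 0)"
  using Cinf_linearD(3)[OF _ smooth_functions_const[of 0] section_zero, of F] by simp

lemma Cinf_linear_sum:
  assumes F: "Cinf_linear E F" and "finite I"
    and "\<And>i. i \<in> I \<Longrightarrow> f i \<in> smooth_functions E" "\<And>i. i \<in> I \<Longrightarrow> s i \<in> sections E"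
  shows "F (\<lambda>p. \<Sum>i\<in>I. f i p *\<^sub>R s i p) = (\<lambda>p. \<Sum>i\<in>I. f i p *\<^sub>R F (s i) p)"
  using assms(2-)
proof (induction I rule: finite_induct)
  case empty
  then show ?case by (simp add: Cinf_linear_zero[OF F])
next
  case (insert i I)
  have "(\<lambda>p. f i p *\<^sub>R s i p) \<in> sections E" "(\<lambda>p. \<Sum>i\<in>I. f i p *\<^sub>R s i p) \<in> sections E"
    using insert.prems by (intro section_sum section_scaleR; simp)+
  then show ?case
    using insert by (simp add: Cinf_linearD(2,3)[OF F])
qed

text \<open>For a bump function f at p and a frame Y with dual coframe e, s is the sum of (1 - f^2)
  s and the terms (f e(s)) (f Y), whose factors are all global. After F is applied, the first
  coefficient vanishes at p since f(p) = 1, and the others since s(p) = 0.\<close>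

lemma Cinf_linear_vanishes:
  assumes F: "Cinf_linear E F" and s: "s \<in> sections E" and p: "s p = 0"
  shows "F s p = 0"
proof -
  obtain V Y where V: "(V, Y) \<in> trivs E" "p \<in> V" by (rule triv_at)
  have Y: "local_frame E V Y" and oV: "open V" using V local_frame_triv triv_open by auto
  obtain f :: "'m \<Rightarrow> real" and K where f: "smooth_fun (charts E) UNIV f" "closed K" "K \<subseteq> V"
    "\<And>q. q \<notin> K \<Longrightarrow> f q = 0" "\<forall>\<^sub>F q in nhds p. f q = 1"
    using bump_function[OF oV V(2)] by metis
  have f': "f \<in> smooth_functions E" using f(1) by (simp add: smooth_functions_def)
  define g where "g a q = f q * dual_coframe E Y a q (s q)" for a q
  define Z where "Z a q = f q *\<^sub>R Y a q" for a q
  have g: "g a \<in> smooth_functions E" if "a < rk E" for a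
    unfolding smooth_functions_def g_def
  proof (intro CollectI smooth_fun_extend_by_zero[OF _ oV f(2,3)] smooth_fun_mult oV)
    show "smooth_fun (charts E) V (\<lambda>q. dual_coframe E Y a q (s q))"
      by (rule smooth_coframe_component[OF Y section_imp_local_section[OF s oV] that])
  qed (use f smooth_fun_subset[OF f(1)] in auto)
  have Z: "Z a \<in> sections E" if "a < rk E" for a
  proof -
    have "local_section E V (Y a)" using Y that by (simp add: local_frame_def)
    from bump_times_section[OF f(1-4) oV this] show ?thesis by (simp add: Z_def[abs_def])
  qed
  have ff: "(f q * f q) *\<^sub>R s q = (\<Sum>a<rk E. g a q *\<^sub>R Z a q)" for q
  proof (cases "q \<in> V")
    case True
    have "(\<Sum>a<rk E. g a q *\<^sub>R Z a q) = (f q * f q) *\<^sub>R (\<Sum>a<rk E. dual_coframe E Y a q (s q) *\<^sub>R Y a q)"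
      by (simp add: g_def Z_def scaleR_sum_right mult_ac)
    then show ?thesis
      using coframe_expansion[OF triv_basis[OF V(1)] True section_fibre[OF s]] by simp
  next
    case False
    then have "f q = 0" using f(3,4) by auto
    then show ?thesis by (simp add: g_def Z_def)
  qed
  have "s = (\<lambda>q. (1 - f q * f q) *\<^sub>R s q + (\<Sum>a<rk E. g a q *\<^sub>R Z a q))"
    by (simp flip: ff scaleR_add_left)
  then have "F s = F (\<lambda>q. (1 - f q * f q) *\<^sub>R s q + (\<Sum>a<rk E. g a q *\<^sub>R Z a q))" by (rule arg_cong)
  also have "\<dots> = (\<lambda>q. F (\<lambda>q. (1 - f q * f q) *\<^sub>R s q) q + F (\<lambda>q. \<Sum>a<rk E. g a q *\<^sub>R Z a q) q)"
    by (intro Cinf_linearD(2)[OF F] section_scaleR smooth_functions_one_minus_square f' s section_sum g Z) auto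
  also have "\<dots> = (\<lambda>q. (1 - f q * f q) *\<^sub>R F s q + (\<Sum>a<rk E. g a q *\<^sub>R F (Z a) q))"
  proof -
    have "F (\<lambda>q. \<Sum>a<rk E. g a q *\<^sub>R Z a q) = (\<lambda>q. \<Sum>a<rk E. g a q *\<^sub>R F (Z a) q)"
      by (rule Cinf_linear_sum[OF F finite_lessThan]) (simp_all add: g Z)
    then show ?thesis
      by (simp add: Cinf_linearD(3)[OF F smooth_functions_one_minus_square[OF f'] s])
  qed
  finally have "F s p = (1 - f p * f p) *\<^sub>R F s p + (\<Sum>a<rk E. g a p *\<^sub>R F (Z a) p)" by metis
  moreover have "f p = 1" using f(5) by (rule eventually_nhds_x_imp_x)
  moreover have "g a p = 0" for a
    by (simp add: g_def p dual_coframe_def real_vector.representation_zero)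
  ultimately show ?thesis by simp
qed

lemma Cinf_linear_pointwise:
  assumes F: "Cinf_linear E F" and s: "s \<in> sections E" "t \<in> sections E" and p: "s p = t p"
  shows "F s p = F t p"
proof -
  have "F (\<lambda>p. (s p - t p) + t p) = (\<lambda>p. F (\<lambda>p. s p - t p) p + F t p)"
    by (intro Cinf_linearD(2)[OF F] section_diff s)
  then have "F s p = F (\<lambda>p. s p - t p) p + F t p" by simp
  then show ?thesis
    using Cinf_linear_vanishes[OF F section_diff[OF s], of p] p by simp
qed

text \<open>Only the value at p matters, so t may be replaced by the combination with constant
  coefficients, to which linearity applies.\<close>

lemma Cinf_linear_combination_at:
  assumes F: "Cinf_linear E F" and "t \<in> sections E" "finite I" "\<And>i. i \<in> I \<Longrightarrow> s i \<in> sections E"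
    and "t p = (\<Sum>i\<in>I. c i *\<^sub>R s i p)"
  shows "F t p = (\<Sum>i\<in>I. c i *\<^sub>R F (s i) p)"
proof -
  have "F t p = F (\<lambda>p. \<Sum>i\<in>I. c i *\<^sub>R s i p) p"
    using assms by (intro Cinf_linear_pointwise[OF F]) (auto intro!: section_sum section_scaleR smooth_functions_const)
  also have "\<dots> = (\<Sum>i\<in>I. c i *\<^sub>R F (s i) p)"
    using Cinf_linear_sum[OF F assms(3) smooth_functions_const assms(4), of "\<lambda>i. i" c] by metis
  finally show ?thesis .
qed

section \<open>One-forms and tensoriality in a one-form argument\<close>

lemma one_formI:
  assumes "\<And>p x y. x \<in> fibre E p \<Longrightarrow> y \<in> fibre E p \<Longrightarrow> \<alpha> p (x + y) = \<alpha> p x + \<alpha> p y"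
    "\<And>p c x. x \<in> fibre E p \<Longrightarrow> \<alpha> p (c *\<^sub>R x) = c * \<alpha> p x"
    "\<And>p x. x \<notin> fibre E p \<Longrightarrow> \<alpha> p x = 0"
    "\<And>U X a. (U, X) \<in> trivs E \<Longrightarrow> a < rk E \<Longrightarrow> smooth_fun (charts E) U (\<lambda>p. \<alpha> p (X a p))"
  shows "\<alpha> \<in> one_forms E"
  using assms by (auto simp: one_forms_def)

lemma one_formD:
  assumes "\<alpha> \<in> one_forms E"
  shows "x \<in> fibre E p \<Longrightarrow> y \<in> fibre E p \<Longrightarrow> \<alpha> p (x + y) = \<alpha> p x + \<alpha> p y"
    "x \<in> fibre E p \<Longrightarrow> \<alpha> p (c *\<^sub>R x) = c * \<alpha> p x"
    "x \<notin> fibre E p \<Longrightarrow> \<alpha> p x = 0"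
    "(U, X) \<in> trivs E \<Longrightarrow> a < rk E \<Longrightarrow> smooth_fun (charts E) U (\<lambda>p. \<alpha> p (X a p))"
  using assms by (auto simp: one_forms_def)

lemma one_form_add: "\<alpha> \<in> one_forms E \<Longrightarrow> \<beta> \<in> one_forms E \<Longrightarrow> (\<lambda>p x. \<alpha> p x + \<beta> p x) \<in> one_forms E"
  by (rule one_formI) (simp_all add: one_formD distrib_left smooth_fun_add triv_open)

lemma one_form_scale:
  assumes "f \<in> smooth_functions E" "\<alpha> \<in> one_forms E"
  shows "(\<lambda>p x. f p * \<alpha> p x) \<in> one_forms E"
proof (rule one_formI)
  fix U X a assume "(U, X) \<in> trivs E" "a < rk E"
  then show "smooth_fun (charts E) U (\<lambda>p. f p * \<alpha> p (X a p))"
    using assms smooth_fun_subset[of "charts E" UNIV f U]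
    by (intro smooth_fun_mult one_formD(4)[OF assms(2)]) (auto simp: smooth_functions_def triv_open)
qed (simp_all add: one_formD[OF assms(2)] distrib_left)

lemma one_form_zero: "(\<lambda>p x. 0) \<in> one_forms E"
  by (auto simp: one_forms_def triv_open smooth_fun_const)

lemma one_form_sum: "(\<And>i. i \<in> I \<Longrightarrow> \<alpha> i \<in> one_forms E) \<Longrightarrow> (\<lambda>p x. \<Sum>i\<in>I. \<alpha> i p x) \<in> one_forms E"
  by (induction I rule: infinite_finite_induct) (simp_all add: one_form_zero one_form_add)

lemma Cinf_linear_formD:
  assumes "Cinf_linear_form E F"
  shows "\<alpha> \<in> one_forms E \<Longrightarrow> F \<alpha> \<in> sections E"
    "\<alpha> \<in> one_forms E \<Longrightarrow> \<beta> \<in> one_forms E \<Longrightarrow> F (\<lambda>p x. \<alpha> p x + \<beta> p x) = (\<lambda>p. F \<alpha> p + F \<beta> p)"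
    "f \<in> smooth_functions E \<Longrightarrow> \<alpha> \<in> one_forms E \<Longrightarrow> F (\<lambda>p x. f p * \<alpha> p x) = (\<lambda>p. f p *\<^sub>R F \<alpha> p)"
  using assms by (simp_all add: Cinf_linear_form_def)

lemma Cinf_linear_form_zero: "Cinf_linear_form E F \<Longrightarrow> F (\<lambda>p x. 0) = (\<lambda>p. 0)"
  using Cinf_linear_formD(3)[OF _ smooth_functions_const[of 0] one_form_zero, of F] by simp

lemma Cinf_linear_form_sum:
  assumes F: "Cinf_linear_form E F" and "finite I"
    and "\<And>i. i \<in> I \<Longrightarrow> f i \<in> smooth_functions E" "\<And>i. i \<in> I \<Longrightarrow> \<alpha> i \<in> one_forms E"
  shows "F (\<lambda>p x. \<Sum>i\<in>I. f i p * \<alpha> i p x) = (\<lambda>p. \<Sum>i\<in>I. f i p *\<^sub>R F (\<alpha> i) p)"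
  using assms(2-)
proof (induction I rule: finite_induct)
  case empty
  then show ?case by (simp add: Cinf_linear_form_zero[OF F])
next
  case (insert i I)
  have "(\<lambda>p x. f i p * \<alpha> i p x) \<in> one_forms E" "(\<lambda>p x. \<Sum>i\<in>I. f i p * \<alpha> i p x) \<in> one_forms E"
    using insert.prems by (intro one_form_sum one_form_scale; simp)+
  then show ?case
    using insert by (simp add: Cinf_linear_formD(2,3)[OF F])
qed

lemma one_form_linear:
  assumes "\<alpha> \<in> one_forms E" "\<And>i. i \<in> I \<Longrightarrow> x i \<in> fibre E p"
  shows "\<alpha> p (\<Sum>i\<in>I. c i *\<^sub>R x i) = (\<Sum>i\<in>I. c i * \<alpha> p (x i))"
proof -
  note add = one_formD(1)[OF assms(1)] and scale = one_formD(2)[OF assms(1)]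
  have zero: "\<alpha> p 0 = 0" using scale[OF subspace_0[OF subspace_fibre], of p 0] by simp
  have mem: "c i *\<^sub>R x i \<in> fibre E p" if "i \<in> I" for i
    using assms(2)[OF that] subspace_scale[OF subspace_fibre] by blast
  show ?thesis using assms(2) mem
    by (induction I rule: infinite_finite_induct)
      (simp_all add: add scale zero subspace_sum[OF subspace_fibre])
qed

text \<open>Outside the fibre both sides are 0 by convention. The identity thus holds on the whole
  ambient space, which is needed because one-forms are compared as functions on it.\<close>

lemma one_form_expansion:
  assumes "\<alpha> \<in> one_forms E" "pointwise_basis E U X" "p \<in> U"
  shows "\<alpha> p x = (\<Sum>a<rk E. \<alpha> p (X a p) * dual_coframe E X a p x)"
proof (cases "x \<in> fibre E p")
  case True
  have "\<alpha> p x = \<alpha> p (\<Sum>a<rk E. dual_coframe E X a p x *\<^sub>R X a p)"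
    by (simp add: coframe_expansion[OF assms(2,3) True])
  also have "\<dots> = (\<Sum>a<rk E. \<alpha> p (X a p) * dual_coframe E X a p x)"
    by (subst one_form_linear[OF assms(1)]) (auto simp: frame_in_fibre[OF assms(2,3)] mult.commute)
  finally show ?thesis .
next
  case False
  then show ?thesis
    using assms(1) by (simp add: one_formD(3) coframe_outside_fibre[OF assms(2,3)])
qed

text \<open>The decomposition used for sections, dualized: \<alpha> is (1 - f^2) \<alpha> plus the
  terms (f \<alpha>(Y)) (f e), with all coefficients vanishing at p.\<close>

lemma Cinf_linear_form_vanishes:
  assumes F: "Cinf_linear_form E F" and \<alpha>: "\<alpha> \<in> one_forms E" and p: "\<alpha> p = (\<lambda>x. 0)"
  shows "F \<alpha> p = 0"
proof -
  obtain V Y where V: "(V, Y) \<in> trivs E" "p \<in> V" by (rule triv_at)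
  have Y: "local_frame E V Y" and oV: "open V" using V local_frame_triv triv_open by auto
  obtain f :: "'m \<Rightarrow> real" and K where f: "smooth_fun (charts E) UNIV f" "closed K" "K \<subseteq> V"
    "\<And>q. q \<notin> K \<Longrightarrow> f q = 0" "\<forall>\<^sub>F q in nhds p. f q = 1"
    using bump_function[OF oV V(2)] by metis
  have f': "f \<in> smooth_functions E" using f(1) by (simp add: smooth_functions_def)
  define g where "g a q = f q * \<alpha> q (Y a q)" for a q
  define Z where "Z a q x = f q * dual_coframe E Y a q x" for a q x
  have g: "g a \<in> smooth_functions E" if "a < rk E" for a
    unfolding smooth_functions_def g_def
  proof (intro CollectI smooth_fun_extend_by_zero[OF _ oV f(2,3)] smooth_fun_mult oV)
    show "smooth_fun (charts E) V (\<lambda>q. \<alpha> q (Y a q))"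
      using \<alpha> V(1) that by (auto simp: one_forms_def)
  qed (use f smooth_fun_subset[OF f(1)] in auto)
  have Z: "Z a \<in> one_forms E" if "a < rk E" for a
    using bump_times_coframe[OF f(1-4) Y that] by (simp add: Z_def[abs_def])
  have ff: "(f q * f q) * \<alpha> q x = (\<Sum>a<rk E. g a q * Z a q x)" for q x
  proof (cases "q \<in> V")
    case True
    show ?thesis
      by (subst one_form_expansion[OF \<alpha> triv_basis[OF V(1)] True])
        (simp add: g_def Z_def sum_distrib_left mult_ac)
  next
    case False
    then have "f q = 0" using f(3,4) by auto
    then show ?thesis by (simp add: g_def Z_def)
  qed
  have "\<alpha> = (\<lambda>q x. (1 - f q * f q) * \<alpha> q x + (\<Sum>a<rk E. g a q * Z a q x))"
    by (simp flip: ff distrib_right)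
  then have "F \<alpha> = F (\<lambda>q x. (1 - f q * f q) * \<alpha> q x + (\<Sum>a<rk E. g a q * Z a q x))" by (rule arg_cong)
  also have "\<dots> = (\<lambda>q. F (\<lambda>q x. (1 - f q * f q) * \<alpha> q x) q + F (\<lambda>q x. \<Sum>a<rk E. g a q * Z a q x) q)"
    by (intro Cinf_linear_formD(2)[OF F] one_form_scale smooth_functions_one_minus_square f' \<alpha> one_form_sum g Z) auto
  also have "\<dots> = (\<lambda>q. (1 - f q * f q) *\<^sub>R F \<alpha> q + (\<Sum>a<rk E. g a q *\<^sub>R F (Z a) q))"
  proof -
    have "F (\<lambda>q x. \<Sum>a<rk E. g a q * Z a q x) = (\<lambda>q. \<Sum>a<rk E. g a q *\<^sub>R F (Z a) q)"
      by (rule Cinf_linear_form_sum[OF F finite_lessThan]) (simp_all add: g Z)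
    then show ?thesis
      by (simp add: Cinf_linear_formD(3)[OF F smooth_functions_one_minus_square[OF f'] \<alpha>])
  qed
  finally have "F \<alpha> p = (1 - f p * f p) *\<^sub>R F \<alpha> p + (\<Sum>a<rk E. g a p *\<^sub>R F (Z a) p)" by metis
  moreover have "f p = 1" using f(5) by (rule eventually_nhds_x_imp_x)
  moreover have "g a p = 0" for a by (simp add: g_def p)
  ultimately show ?thesis by simp
qed

lemma Cinf_linear_form_combination_at:
  assumes F: "Cinf_linear_form E F" and \<alpha>: "\<alpha> \<in> one_forms E" and "finite I"
    and \<beta>: "\<And>i. i \<in> I \<Longrightarrow> \<beta> i \<in> one_forms E" and eq: "\<alpha> p = (\<lambda>x. \<Sum>i\<in>I. c i * \<beta> i p x)"
  shows "F \<alpha> p = (\<Sum>i\<in>I. c i *\<^sub>R F (\<beta> i) p)"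
proof -
  let ?\<sigma> = "\<lambda>p x. \<Sum>i\<in>I. c i * \<beta> i p x" and ?\<delta> = "\<lambda>p x. \<alpha> p x + - 1 * (\<Sum>i\<in>I. c i * \<beta> i p x)"
  have \<sigma>: "?\<sigma> \<in> one_forms E" by (intro one_form_sum one_form_scale smooth_functions_const \<beta>)
  have \<delta>: "?\<delta> \<in> one_forms E" by (intro one_form_add \<alpha> one_form_scale[OF smooth_functions_const \<sigma>])
  have "F (\<lambda>p x. ?\<delta> p x + ?\<sigma> p x) = (\<lambda>p. F ?\<delta> p + F ?\<sigma> p)"
    by (rule Cinf_linear_formD(2)[OF F \<delta> \<sigma>])
  then have "F \<alpha> p = F ?\<delta> p + F ?\<sigma> p" by simp
  also have "F ?\<delta> p = 0" by (rule Cinf_linear_form_vanishes[OF F \<delta>]) (simp add: eq)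
  also have "F ?\<sigma> p = (\<Sum>i\<in>I. c i *\<^sub>R F (\<beta> i) p)"
    using Cinf_linear_form_sum[OF F assms(3) smooth_functions_const \<beta>, of "\<lambda>i. i" c] by metis
  finally show ?thesis by simp
qed

text \<open>Satisfied by the locality operator and by its projection, so that one study of
  contractions serves both modified brackets.\<close>

definition trilinear ::
  "(('m \<Rightarrow> 'v \<Rightarrow> real) \<Rightarrow> ('m \<Rightarrow> 'v) \<Rightarrow> ('m \<Rightarrow> 'v) \<Rightarrow> ('m \<Rightarrow> 'v)) \<Rightarrow> bool" where
  "trilinear K \<longleftrightarrow>
     (\<forall>u\<in>sections E. \<forall>v\<in>sections E. Cinf_linear_form E (\<lambda>\<alpha>. K \<alpha> u v)) \<and>
     (\<forall>\<alpha>\<in>one_forms E. \<forall>v\<in>sections E. Cinf_linear E (\<lambda>u. K \<alpha> u v)) \<and>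
     (\<forall>\<alpha>\<in>one_forms E. \<forall>u\<in>sections E. Cinf_linear E (\<lambda>v. K \<alpha> u v))"

lemma trilinear_section:
  "trilinear K \<Longrightarrow> \<alpha> \<in> one_forms E \<Longrightarrow> u \<in> sections E \<Longrightarrow> v \<in> sections E \<Longrightarrow> K \<alpha> u v \<in> sections E"
  using Cinf_linearD(1)[of "K \<alpha> u" v] by (simp add: trilinear_def)

text \<open>The two summation indices are independent because a change of frame expands covector and
  vector separately; the two coefficient matrices meet only in the later sum over the frame.\<close>

lemma trilinear_combination_at:
  assumes K: "trilinear K" and "\<alpha> \<in> one_forms E" "t \<in> sections E" "v \<in> sections E" "w \<in> sections E"
    and I: "finite I" and \<beta>: "\<And>i. i \<in> I \<Longrightarrow> \<beta> i \<in> one_forms E" and s: "\<And>i. i \<in> I \<Longrightarrow> s i \<in> sections E"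
    and eq: "\<alpha> p = (\<lambda>x. \<Sum>i\<in>I. h i * \<beta> i p x)" "t p = (\<Sum>i\<in>I. g i *\<^sub>R s i p)" "v p = w p"
  shows "K \<alpha> t v p = (\<Sum>c\<in>I. \<Sum>b\<in>I. (h c * g b) *\<^sub>R K (\<beta> c) (s b) w p)"
proof -
  have "K \<alpha> t v p = K \<alpha> t w p"
    using K assms(2-5) eq(3) Cinf_linear_pointwise[of "K \<alpha> t" v w p] by (simp add: trilinear_def)
  also have "\<dots> = (\<Sum>c\<in>I. h c *\<^sub>R K (\<beta> c) t w p)"
    using K assms(2-5) eq(1) \<beta> I
    by (intro Cinf_linear_form_combination_at[of "\<lambda>\<alpha>. K \<alpha> t w"]) (auto simp: trilinear_def)
  also have "\<dots> = (\<Sum>c\<in>I. h c *\<^sub>R (\<Sum>b\<in>I. g b *\<^sub>R K (\<beta> c) (s b) w p))"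
  proof (rule sum.cong[OF refl])
    fix c assume c: "c \<in> I"
    have "Cinf_linear E (\<lambda>u. K (\<beta> c) u w)" using K \<beta>[OF c] assms(5) by (simp add: trilinear_def)
    from Cinf_linear_combination_at[OF this assms(3) I s eq(2)]
    show "h c *\<^sub>R K (\<beta> c) t w p = h c *\<^sub>R (\<Sum>b\<in>I. g b *\<^sub>R K (\<beta> c) (s b) w p)" by simp
  qed
  finally show ?thesis by (simp add: scaleR_sum_right)
qed

end

section \<open>Local operators on sections\<close>

context smooth_bundle
begin

definition local_operator :: "(('m \<Rightarrow> 'v) \<Rightarrow> ('m \<Rightarrow> 'v) \<Rightarrow> ('m \<Rightarrow> 'v)) \<Rightarrow> bool" where
  "local_operator B \<longleftrightarrow> (\<forall>p. \<forall>u\<in>sections E. \<forall>u'\<in>sections E. \<forall>v\<in>sections E. \<forall>v'\<in>sections E.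
     (\<forall>\<^sub>F q in nhds p. u q = u' q) \<longrightarrow> (\<forall>\<^sub>F q in nhds p. v q = v' q) \<longrightarrow> B u v p = B u' v' p)"

lemma local_operatorD:
  assumes "local_operator B" "u \<in> sections E" "u' \<in> sections E" "v \<in> sections E" "v' \<in> sections E"
    "\<forall>\<^sub>F q in nhds p. u q = u' q" "\<forall>\<^sub>F q in nhds p. v q = v' q"
  shows "B u v p = B u' v' p"
  by (rule assms(1)[unfolded local_operator_def, rule_format, OF assms(2-7)])

text \<open>\<open>restr2\<close> uses new extensions at every point; locality allows the single
  pair \<open>u'\<close>, \<open>v'\<close> to replace them throughout a neighbourhood. Hence the
  result is a smooth local section and can be fed into an operator again.\<close>

lemma restr2_eventually_eq:
  assumes B: "local_operator B" and W: "open W" "p \<in> W" and loc: "local_section E W u" "local_section E W v"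
    and s: "u' \<in> sections E" "v' \<in> sections E"
    and eq: "\<forall>\<^sub>F q in nhds p. u' q = u q" "\<forall>\<^sub>F q in nhds p. v' q = v q"
  shows "\<forall>\<^sub>F q in nhds p. restr2 E B u v q = B u' v' q"
proof -
  have "\<forall>\<^sub>F q in nhds p. q \<in> W" using W by (auto simp: eventually_nhds)
  \<comment> \<open>Equality near p is also equality near each q close to p, so the extensions
    chosen at q have the germs of \<open>u'\<close> and \<open>v'\<close> at q.\<close>
  moreover have "\<forall>\<^sub>F q in nhds p. \<forall>\<^sub>F r in nhds q. u' r = u r" using eq(1) by (simp add: eventually_eventually)
  moreover have "\<forall>\<^sub>F q in nhds p. \<forall>\<^sub>F r in nhds q. v' r = v r" using eq(2) by (simp add: eventually_eventually)
  ultimately show ?thesis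
  proof eventually_elim
    case (elim q)
    note g = germ_ext[OF W(1) elim(1) loc(1)] germ_ext[OF W(1) elim(1) loc(2)]
    have 1: "\<forall>\<^sub>F r in nhds q. germ_ext E q u r = u' r" using g(2) elim(2) by eventually_elim simp
    have 2: "\<forall>\<^sub>F r in nhds q. germ_ext E q v r = v' r" using g(4) elim(3) by eventually_elim simp
    show ?case
      unfolding restr2_def by (rule local_operatorD[OF B g(1) s(1) g(3) s(2) 1 2])
  qed
qed

lemma restr2_local_section:
  assumes B: "local_operator B" "R_bilinear E B" and W: "open W"
    and loc: "local_section E W u" "local_section E W v"
  shows "local_section E W (restr2 E B u v)"
proof (rule local_section_eventually[OF W])
  fix p assume p: "p \<in> W"
  note g = germ_ext[OF W p loc(1)] germ_ext[OF W p loc(2)]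
  have "B (germ_ext E p u) (germ_ext E p v) \<in> sections E"
    using B(2) g by (simp add: R_bilinear_def R_linear_def)
  then show "\<exists>t\<in>sections E. \<forall>\<^sub>F q in nhds p. restr2 E B u v q = t q"
    using restr2_eventually_eq[OF B(1) W p loc g(1,3,2,4)] by blast
qed

lemma restr2_germ_cong:
  assumes "\<forall>\<^sub>F q in nhds p. u q = u' q" "\<forall>\<^sub>F q in nhds p. v q = v' q"
  shows "\<forall>\<^sub>F q in nhds p. restr2 E B u v q = restr2 E B u' v' q"
proof -
  have "\<forall>\<^sub>F q in nhds p. \<forall>\<^sub>F r in nhds q. u r = u' r" "\<forall>\<^sub>F q in nhds p. \<forall>\<^sub>F r in nhds q. v r = v' r"
    using assms by (simp_all add: eventually_eventually)
  then show ?thesis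
    by eventually_elim (simp add: restr2_def germ_ext_cong)
qed

text \<open>The frame chosen at p depends on p alone and all other ingredients on germs at p, so the
  contraction is local by its very encoding. This makes it available for proving locality of the
  bracket.\<close>

lemma frame_contraction_germ_cong:
  assumes "\<forall>\<^sub>F q in nhds p. u q = u' q" "\<forall>\<^sub>F q in nhds p. v q = v' q"
  shows "frame_contraction E K B u v p = frame_contraction E K B u' v' p"
proof -
  have "germ_ext E p (restr2 E B x u) = germ_ext E p (restr2 E B x u')" for x
    by (rule germ_ext_cong[OF restr2_germ_cong]) (simp_all add: assms)
  then show ?thesis
    by (simp add: frame_contraction_def restr3_def Let_def germ_ext_cong[OF assms(2)])
qed

lemma R_linearD:
  assumes "R_linear E F"
  shows "s \<in> sections E \<Longrightarrow> F s \<in> sections E"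
    "s \<in> sections E \<Longrightarrow> t \<in> sections E \<Longrightarrow> F (\<lambda>p. s p + t p) = (\<lambda>p. F s p + F t p)"
    "s \<in> sections E \<Longrightarrow> F (\<lambda>p. c *\<^sub>R s p) = (\<lambda>p. c *\<^sub>R F s p)"
  using assms by (simp_all add: R_linear_def)

lemma R_linear_zero: "R_linear E F \<Longrightarrow> F (\<lambda>p. 0) = (\<lambda>p. 0)"
  using R_linearD(3)[OF _ section_zero, of F 0] by simp

end

section \<open>Anchored bundles and connections\<close>

locale anchored =
  fixes E :: "('m::{t2_space,second_countable_topology}, 'b::real_inner, 'v::real_vector, 'z) anchored_bundle_scheme"
  assumes anchored: "anchored_vector_bundle E"
begin

sublocale smooth_bundle E
  using anchored by unfold_locales (simp add: anchored_vector_bundle_def)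

lemma anchor_cong:
  assumes "x \<in> fibre E p" "smooth_near (charts E) p f" "smooth_near (charts E) p g"
    "\<forall>\<^sub>F q in nhds p. f q = g q"
  shows "anchor E p x f = anchor E p x g"
proof -
  have "anchor E p x \<in> tangent_space (charts E) p"
    using anchored assms(1) by (simp add: anchored_vector_bundle_def)
  then show ?thesis using assms(2-4) unfolding tangent_space_def by blast
qed

text \<open>The common behaviour of the connection and of the bracket in their second argument, so
  that locality there is proved once.\<close>

definition Leibniz :: "('m \<Rightarrow> 'v) \<Rightarrow> (('m \<Rightarrow> 'v) \<Rightarrow> ('m \<Rightarrow> 'v)) \<Rightarrow> bool" where
  "Leibniz u F \<longleftrightarrow> R_linear E F \<and> (\<forall>v\<in>sections E. \<forall>f\<in>smooth_functions E.
     F (\<lambda>p. f p *\<^sub>R v p) = (\<lambda>p. act E u f p *\<^sub>R v p + f p *\<^sub>R F v p))"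

lemma LeibnizD:
  assumes "Leibniz u F"
  shows "R_linear E F"
    "v \<in> sections E \<Longrightarrow> f \<in> smooth_functions E \<Longrightarrow>
      F (\<lambda>p. f p *\<^sub>R v p) = (\<lambda>p. act E u f p *\<^sub>R v p + f p *\<^sub>R F v p)"
  using assms by (simp_all add: Leibniz_def)

text \<open>Let d = v - w vanish on W and let f be a bump function supported in W. Then f d = 0
  globally, and the Leibniz rule at p, where f = 1 and d = 0, leaves F d p = 0.\<close>

lemma Leibniz_local:
  assumes F: "Leibniz u F" and s: "v \<in> sections E" "w \<in> sections E"
    and eq: "\<forall>\<^sub>F q in nhds p. v q = w q"
  shows "F v p = F w p"
proof -
  define d where "d q = v q - w q" for q
  have d: "d \<in> sections E" using section_diff[OF s] by (simp add: d_def[abs_def])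
  obtain W where W: "open W" "p \<in> W" "\<And>q. q \<in> W \<Longrightarrow> d q = 0"
    using eq unfolding eventually_nhds d_def by auto
  obtain f :: "'m \<Rightarrow> real" and K where f: "smooth_fun (charts E) UNIV f" "closed K" "K \<subseteq> W"
    "\<And>q. q \<notin> K \<Longrightarrow> f q = 0" "\<forall>\<^sub>F q in nhds p. f q = 1"
    using bump_function[OF W(1,2)] by metis
  have "(\<lambda>q. f q *\<^sub>R d q) = (\<lambda>q. 0)"
    using f(3,4) W(3) by (metis scale_zero_left scale_zero_right subsetD)
  then have "(\<lambda>p. act E u f p *\<^sub>R d p + f p *\<^sub>R F d p) = (\<lambda>q. 0)"
    using LeibnizD(2)[OF F d, of f] f(1) R_linear_zero[OF LeibnizD(1)[OF F]]
    by (simp add: smooth_functions_def)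
  then have "act E u f p *\<^sub>R d p + f p *\<^sub>R F d p = 0" by metis
  moreover have "f p = 1" using f(5) by (rule eventually_nhds_x_imp_x)
  ultimately have "F d p = 0" using W(2,3) by simp
  moreover have "F (\<lambda>q. d q + w q) = (\<lambda>q. F d q + F w q)"
    by (rule R_linearD(2)[OF LeibnizD(1)[OF F] d s(2)])
  then have "F v = (\<lambda>q. F d q + F w q)" by (simp add: d_def)
  ultimately show ?thesis by simp
qed

lemma Leibniz_sum:
  assumes F: "Leibniz u F" and "finite I"
    and "\<And>i. i \<in> I \<Longrightarrow> f i \<in> smooth_functions E" "\<And>i. i \<in> I \<Longrightarrow> s i \<in> sections E"
  shows "F (\<lambda>p. \<Sum>i\<in>I. f i p *\<^sub>R s i p) = (\<lambda>p. \<Sum>i\<in>I. act E u (f i) p *\<^sub>R s i p + f i p *\<^sub>R F (s i) p)"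
  using assms(2-)
proof (induction I rule: finite_induct)
  case empty
  then show ?case by (simp add: R_linear_zero[OF LeibnizD(1)[OF F]])
next
  case (insert i I)
  have "(\<lambda>p. f i p *\<^sub>R s i p) \<in> sections E" "(\<lambda>p. \<Sum>i\<in>I. f i p *\<^sub>R s i p) \<in> sections E"
    using insert.prems by (intro section_sum section_scaleR; simp)+
  then show ?case
    using insert by (simp add: R_linearD(2)[OF LeibnizD(1)[OF F]] LeibnizD(2)[OF F])
qed

end

locale connection = anchored E
  for E :: "('m::{t2_space,second_countable_topology}, 'b::real_inner, 'v::real_vector, 'z) anchored_bundle_scheme" +
  fixes nab :: "('m \<Rightarrow> 'v) \<Rightarrow> ('m \<Rightarrow> 'v) \<Rightarrow> ('m \<Rightarrow> 'v)"
  assumes linear_connection: "linear_connection E nab"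
begin

lemma nab_bilinear: "R_bilinear E nab"
  using linear_connection by (simp add: linear_connection_def)

lemmas nab_scaleR = bspec[OF bspec[OF bspec[OF
  conjunct2[OF linear_connection[unfolded linear_connection_def]]]]]

lemma nab_section: "u \<in> sections E \<Longrightarrow> v \<in> sections E \<Longrightarrow> nab u v \<in> sections E"
  using nab_bilinear R_linearD(1)[of "nab u" v] by (simp add: R_bilinear_def)

lemma nab_Leibniz:
  assumes u: "u \<in> sections E"
  shows "Leibniz u (nab u)"
  unfolding Leibniz_def
proof (intro conjI ballI)
  show "R_linear E (nab u)" using nab_bilinear u by (simp add: R_bilinear_def)
  fix v f assume "v \<in> sections E" "f \<in> smooth_functions E"
  then show "nab u (\<lambda>p. f p *\<^sub>R v p) = (\<lambda>p. act E u f p *\<^sub>R v p + f p *\<^sub>R nab u v p)"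
    by (rule nab_scaleR[OF u, THEN conjunct1])
qed

lemma nab_Cinf_linear:
  assumes v: "v \<in> sections E"
  shows "Cinf_linear E (\<lambda>u. nab u v)"
  unfolding Cinf_linear_def
proof (intro conjI ballI)
  have lin: "R_linear E (\<lambda>u. nab u v)" using nab_bilinear v by (simp add: R_bilinear_def)
  fix s t assume s: "s \<in> sections E"
  show "nab s v \<in> sections E" by (rule nab_section[OF s v])
  show "nab (\<lambda>p. s p + t p) v = (\<lambda>p. nab s v p + nab t v p)" if "t \<in> sections E"
    by (rule R_linearD(2)[OF lin s that])
next
  fix f s assume "f \<in> smooth_functions E" "s \<in> sections E"
  then show "nab (\<lambda>p. f p *\<^sub>R s p) v = (\<lambda>p. f p *\<^sub>R nab s v p)"
    by (intro nab_scaleR[OF _ v, THEN conjunct2])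
qed

lemma nab_local: "local_operator nab"
  unfolding local_operator_def
proof (intro allI ballI impI)
  fix p u u' v v'
  assume s: "u \<in> sections E" "u' \<in> sections E" "v \<in> sections E" "v' \<in> sections E"
    and eq: "\<forall>\<^sub>F q in nhds p. u q = u' q" "\<forall>\<^sub>F q in nhds p. v q = v' q"
  have "nab u v p = nab u' v p"
    using Cinf_linear_pointwise[OF nab_Cinf_linear[OF s(3)] s(1,2) eventually_nhds_x_imp_x[OF eq(1)]] .
  also have "\<dots> = nab u' v' p"
    using Leibniz_local[OF nab_Leibniz[OF s(2)] s(3,4) eq(2)] .
  finally show "nab u v p = nab u' v' p" .
qed

lemmas restr2_nab_section = restr2_local_section[OF nab_local nab_bilinear]

lemma restr2_nab_fibre:
  assumes "open W" "p \<in> W" "local_section E W u" "local_section E W v"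
  shows "restr2 E nab u v p \<in> fibre E p"
  using restr2_nab_section[OF assms(1,3,4)] assms(2) by (rule local_section_fibre)

lemma coframe_nab:
  assumes X: "local_frame E U X" and loc: "local_section E U u" "local_section E U v"
    and p: "p \<in> U" and a: "a < rk E"
  shows "dual_coframe E X a p (restr2 E nab u v p) =
    act E u (\<lambda>q. dual_coframe E X a q (v q)) p
    + (\<Sum>c<rk E. dual_coframe E X c p (v p) * dual_coframe E X a p (restr2 E nab u (X c) p))"
proof -
  have U: "open U" and basis: "pointwise_basis E U X" and Xl: "\<And>c. c < rk E \<Longrightarrow> local_section E U (X c)"
    using X by (auto simp: local_frame_def)
  define u' where "u' = germ_ext E p u"
  define v' where "v' = germ_ext E p v"
  define X' where "X' c = germ_ext E p (X c)" for c
  have u': "u' \<in> sections E" "\<forall>\<^sub>F q in nhds p. u' q = u q"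
    using germ_ext[OF U p loc(1)] by (auto simp: u'_def)
  have v': "v' \<in> sections E" "\<forall>\<^sub>F q in nhds p. v' q = v q"
    using germ_ext[OF U p loc(2)] by (auto simp: v'_def)
  have X': "X' c \<in> sections E" "\<forall>\<^sub>F q in nhds p. X' c q = X c q" if "c < rk E" for c
    using germ_ext[OF U p Xl[OF that]] by (auto simp: X'_def)
  obtain f :: "'m \<Rightarrow> real" and K where f: "smooth_fun (charts E) UNIV f" "closed K" "K \<subseteq> U"
    "\<And>q. q \<notin> K \<Longrightarrow> f q = 0" "\<forall>\<^sub>F q in nhds p. f q = 1"
    using bump_function[OF U p] by metis
  have fp: "f p = 1" using f(5) by (rule eventually_nhds_x_imp_x)
  \<comment> \<open>The cutoff turns the components of v into global smooth functions. With the
    extended frame vectors \<open>X'\<close>, the sum of \<open>g c\<close> times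
    \<open>X' c\<close> agrees with \<open>v'\<close> near p only, and locality in the second
    argument makes this enough.\<close>
  define g where "g c q = f q * dual_coframe E X c q (v q)" for c q
  have comp: "smooth_fun (charts E) U (\<lambda>q. dual_coframe E X c q (v q))" if "c < rk E" for c
    by (rule smooth_coframe_component[OF X loc(2) that])
  have g: "g c \<in> smooth_functions E" if "c < rk E" for c
    unfolding smooth_functions_def g_def
    by (intro CollectI smooth_fun_extend_by_zero[OF _ U f(2,3)] smooth_fun_mult U comp that)
      (use f smooth_fun_subset[OF f(1)] in auto)
  have inU: "\<forall>\<^sub>F q in nhds p. q \<in> U" using U p by (auto simp: eventually_nhds)
  have "\<forall>\<^sub>F q in nhds p. \<forall>c\<in>{..<rk E}. X' c q = X c q"
    using X'(2) by (intro eventually_ball_finite) auto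
  with v'(2) f(5) inU have "\<forall>\<^sub>F q in nhds p. v' q = (\<Sum>c<rk E. g c q *\<^sub>R X' c q)"
  proof eventually_elim
    case (elim q)
    have "(\<Sum>c<rk E. g c q *\<^sub>R X' c q) = (\<Sum>c<rk E. dual_coframe E X c q (v q) *\<^sub>R X c q)"
      using elim(2,4) by (intro sum.cong) (auto simp: g_def)
    also have "\<dots> = v q"
      by (rule coframe_expansion[OF basis elim(3) local_section_fibre[OF loc(2) elim(3)]])
    finally show ?case using elim(1) by simp
  qed
  then have "nab u' v' p = nab u' (\<lambda>q. \<Sum>c<rk E. g c q *\<^sub>R X' c q) p"
    by (intro Leibniz_local[OF nab_Leibniz[OF u'(1)] v'(1)] section_sum section_scaleR) (simp_all add: g X')
  also have "\<dots> = (\<Sum>c<rk E. act E u' (g c) p *\<^sub>R X' c p + g c p *\<^sub>R nab u' (X' c) p)"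
    by (subst Leibniz_sum[OF nab_Leibniz[OF u'(1)]]) (simp_all add: g X')
  also have "\<dots> = (\<Sum>c<rk E. act E u' (g c) p *\<^sub>R X c p) +
      (\<Sum>c<rk E. dual_coframe E X c p (v p) *\<^sub>R restr2 E nab u (X c) p)"
    using eventually_nhds_x_imp_x[OF X'(2)]
    by (simp add: sum.distrib g_def fp restr2_def u'_def X'_def)
  finally have "dual_coframe E X a p (restr2 E nab u v p) =
      dual_coframe E X a p ((\<Sum>c<rk E. act E u' (g c) p *\<^sub>R X c p) +
        (\<Sum>c<rk E. dual_coframe E X c p (v p) *\<^sub>R restr2 E nab u (X c) p))"
    by (simp add: restr2_def u'_def v'_def)
  also have "\<dots> = act E u' (g a) p +
      dual_coframe E X a p (\<Sum>c<rk E. dual_coframe E X c p (v p) *\<^sub>R restr2 E nab u (X c) p)"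
    using frame_in_fibre[OF basis p] restr2_nab_fibre[OF U p loc(1) Xl]
    by (subst coframe_add[OF basis p])
      (auto simp: coframe_combination[OF basis p a] intro!: subspace_sum[OF subspace_fibre] subspace_scale[OF subspace_fibre])
  also have "dual_coframe E X a p (\<Sum>c<rk E. dual_coframe E X c p (v p) *\<^sub>R restr2 E nab u (X c) p) =
      (\<Sum>c<rk E. dual_coframe E X c p (v p) * dual_coframe E X a p (restr2 E nab u (X c) p))"
    using restr2_nab_fibre[OF U p loc(1) Xl]
    by (subst coframe_sum[OF basis p])
      (auto simp: coframe_scale[OF basis p] subspace_scale[OF subspace_fibre])
  \<comment> \<open>The anchor yields a derivation of germs, so the factor f, equal to 1 near p, is
    not seen.\<close>
  also have "act E u' (g a) p = act E u (\<lambda>q. dual_coframe E X a q (v q)) p"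
    unfolding act_def eventually_nhds_x_imp_x[OF u'(2)]
  proof (rule anchor_cong)
    show "u p \<in> fibre E p" by (rule local_section_fibre[OF loc(1) p])
    show "smooth_near (charts E) p (g a)"
      using g[OF a] by (auto simp: smooth_near_def smooth_functions_def intro!: exI[of _ UNIV])
    show "smooth_near (charts E) p (\<lambda>q. dual_coframe E X a q (v q))"
      using comp[OF a] U p by (auto simp: smooth_near_def)
    show "\<forall>\<^sub>F q in nhds p. g a q = dual_coframe E X a q (v q)"
      using f(5) by eventually_elim (simp add: g_def)
  qed
  finally show ?thesis .
qed

text \<open>Independence of the frame: the contraction can be computed near \<open>p\<close> with a fixed frame.\<close>

lemma frame_contraction_eventually_eq:
  assumes K: "trilinear K" and Y: "local_frame E W Y" and p: "p \<in> W"
    and loc: "local_section E W u" "local_section E W v"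
  shows "\<forall>\<^sub>F q in nhds p. frame_contraction E K nab u v q =
    (\<Sum>b<rk E. K (germ_ext_form E p (dual_coframe E Y b)) (germ_ext E p (restr2 E nab (Y b) u)) (germ_ext E p v) q)"
proof -
  have W: "open W" and bY: "pointwise_basis E W Y" and Yl: "\<And>c. c < rk E \<Longrightarrow> local_section E W (Y c)"
    using Y by (auto simp: local_frame_def)
  \<comment> \<open>These extensions are chosen at p and kept fixed; the ones below are chosen again
    at each nearby q, as the definition of the contraction demands.\<close>
  define \<beta> where "\<beta> b = germ_ext_form E p (dual_coframe E Y b)" for b
  define s where "s b = germ_ext E p (restr2 E nab (Y b) u)" for b
  define v' where "v' = germ_ext E p v"
  have \<beta>: "\<beta> b \<in> one_forms E" "\<forall>\<^sub>F q in nhds p. \<beta> b q = dual_coframe E Y b q" if "b < rk E" for b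
    using germ_ext_form[OF Y p that] by (auto simp: \<beta>_def)
  have s: "s b \<in> sections E" "\<forall>\<^sub>F q in nhds p. s b q = restr2 E nab (Y b) u q" if "b < rk E" for b
    using germ_ext[OF W p restr2_nab_section[OF W Yl[OF that] loc(1)]] by (auto simp: s_def)
  have v': "v' \<in> sections E" "\<forall>\<^sub>F q in nhds p. v' q = v q"
    using germ_ext[OF W p loc(2)] by (auto simp: v'_def)
  have "\<forall>\<^sub>F q in nhds p. q \<in> W" using W p by (auto simp: eventually_nhds)
  moreover have "\<forall>\<^sub>F q in nhds p. \<forall>b\<in>{..<rk E}. \<beta> b q = dual_coframe E Y b q"
    using \<beta>(2) by (intro eventually_ball_finite) auto
  moreover have "\<forall>\<^sub>F q in nhds p. \<forall>b\<in>{..<rk E}. s b q = restr2 E nab (Y b) u q"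
    using s(2) by (intro eventually_ball_finite) auto
  ultimately have "\<forall>\<^sub>F q in nhds p. frame_contraction E K nab u v q = (\<Sum>b<rk E. K (\<beta> b) (s b) v' q)"
    using v'(2)
  proof eventually_elim
    case (elim q)
    note q = elim(1)
    define X where "X = some_frame_at E q"
    obtain U where qU: "q \<in> U" and X: "local_frame E U X"
      unfolding X_def by (rule some_frame_at)
    have U: "open U" and bX: "pointwise_basis E U X" and Xl: "\<And>c. c < rk E \<Longrightarrow> local_section E U (X c)"
      using X by (auto simp: local_frame_def)
    have UW: "open (U \<inter> W)" "q \<in> U \<inter> W" using U W qU q by auto
    have Xl': "local_section E (U \<inter> W) (X c)" if "c < rk E" for c
      using local_section_subset[OF Xl[OF that] _ U UW(1)] by auto
    have loc': "local_section E (U \<inter> W) u" using local_section_subset[OF loc(1) _ W UW(1)] by auto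
    define \<alpha> where "\<alpha> a = germ_ext_form E q (dual_coframe E X a)" for a
    define t where "t a = germ_ext E q (restr2 E nab (X a) u)" for a
    define w where "w = germ_ext E q v"
    have \<alpha>: "\<alpha> a \<in> one_forms E" "\<alpha> a q = dual_coframe E X a q" if "a < rk E" for a
      using germ_ext_form[OF X qU that] by (auto simp: \<alpha>_def dest: eventually_nhds_x_imp_x)
    have t: "t a \<in> sections E" "t a q = restr2 E nab (X a) u q" if "a < rk E" for a
      using germ_ext[OF UW restr2_nab_section[OF UW(1) Xl'[OF that] loc']]
      by (auto simp: t_def dest: eventually_nhds_x_imp_x)
    have w: "w \<in> sections E" "w q = v q"
      using germ_ext[OF W q loc(2)] by (auto simp: w_def dest: eventually_nhds_x_imp_x)
    \<comment> \<open>The two transition matrices between the frame chosen at q and Y. The chosen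
      coframe expands with \<open>?h\<close>, and by tensoriality of the connection in its first
      argument the derivatives along X expand with \<open>?g\<close>; the sum over a then gives the
      Kronecker delta.\<close>
    let ?h = "\<lambda>a c. dual_coframe E X a q (Y c q)" and ?g = "\<lambda>a b. dual_coframe E Y b q (X a q)"
    have \<alpha>\<beta>: "\<alpha> a q = (\<lambda>x. \<Sum>c<rk E. ?h a c * \<beta> c q x)" if "a < rk E" for a
    proof
      fix x
      have "\<alpha> a q x = (\<Sum>c<rk E. \<alpha> a q (Y c q) * dual_coframe E Y c q x)"
        by (rule one_form_expansion[OF \<alpha>(1)[OF that] bY q])
      also have "\<dots> = (\<Sum>c<rk E. ?h a c * \<beta> c q x)"
        using elim(2) by (intro sum.cong) (auto simp: \<alpha>(2)[OF that])
      finally show "\<alpha> a q x = (\<Sum>c<rk E. ?h a c * \<beta> c q x)" .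
    qed
    have ts: "t a q = (\<Sum>b<rk E. ?g a b *\<^sub>R s b q)" if a: "a < rk E" for a
    proof -
      have u': "germ_ext E q u \<in> sections E" using germ_ext[OF W q loc(1)] by simp
      have Y': "germ_ext E q (Y b) \<in> sections E" "germ_ext E q (Y b) q = Y b q" if "b < rk E" for b
        using germ_ext[OF W q Yl[OF that]] by (auto dest: eventually_nhds_x_imp_x)
      have X': "germ_ext E q (X a) \<in> sections E" "germ_ext E q (X a) q = X a q"
        using germ_ext[OF U qU Xl[OF a]] by (auto dest: eventually_nhds_x_imp_x)
      have "X a q = (\<Sum>b<rk E. ?g a b *\<^sub>R Y b q)"
        using coframe_expansion[OF bY q local_section_fibre[OF Xl[OF a] qU]] by simp
      then have "nab (germ_ext E q (X a)) (germ_ext E q u) q =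
          (\<Sum>b<rk E. ?g a b *\<^sub>R nab (germ_ext E q (Y b)) (germ_ext E q u) q)"
        using X' Y' by (intro Cinf_linear_combination_at[OF nab_Cinf_linear[OF u']]) auto
      then show ?thesis using t(2)[OF a] elim(3) by (simp add: restr2_def)
    qed
    have delta: "(\<Sum>a<rk E. ?h a c * ?g a b) = (if c = b then 1 else 0)" if "c < rk E" "b < rk E" for c b
    proof -
      have f: "Y c q \<in> fibre E q" by (rule frame_in_fibre[OF bY q that(1)])
      have "(if b = c then 1 else 0) = dual_coframe E Y b q (Y c q)"
        by (simp add: coframe_frame[OF bY q that(2,1)])
      also have "\<dots> = dual_coframe E Y b q (\<Sum>a<rk E. ?h a c *\<^sub>R X a q)"
        by (simp add: coframe_expansion[OF bX qU f])
      also have "\<dots> = (\<Sum>a<rk E. ?h a c * ?g a b)"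
        using frame_in_fibre[OF bX qU]
        by (subst coframe_sum[OF bY q]) (auto simp: coframe_scale[OF bY q] subspace_scale[OF subspace_fibre])
      finally show ?thesis by auto
    qed
    have "frame_contraction E K nab u v q = (\<Sum>a<rk E. K (\<alpha> a) (t a) w q)"
      by (simp add: frame_contraction_def restr3_def Let_def X_def \<alpha>_def t_def w_def)
    also have "\<dots> = (\<Sum>a<rk E. \<Sum>c<rk E. \<Sum>b<rk E. (?h a c * ?g a b) *\<^sub>R K (\<beta> c) (s b) v' q)"
    proof (rule sum.cong[OF refl])
      fix a assume "a \<in> {..<rk E}"
      then have a: "a < rk E" by simp
      show "K (\<alpha> a) (t a) w q = (\<Sum>c<rk E. \<Sum>b<rk E. (?h a c * ?g a b) *\<^sub>R K (\<beta> c) (s b) v' q)"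
        using \<beta>(1) s(1) elim(4) w(2) \<alpha>\<beta>[OF a] ts[OF a]
        by (intro trilinear_combination_at[OF K \<alpha>(1)[OF a] t(1)[OF a] w(1) v'(1)]) auto
    qed
    also have "\<dots> = (\<Sum>c<rk E. \<Sum>b<rk E. \<Sum>a<rk E. (?h a c * ?g a b) *\<^sub>R K (\<beta> c) (s b) v' q)"
      by (subst sum.swap) (rule sum.cong[OF refl sum.swap])
    also have "\<dots> = (\<Sum>c<rk E. \<Sum>b<rk E. (if c = b then 1 else 0) *\<^sub>R K (\<beta> c) (s b) v' q)"
      by (intro sum.cong refl) (simp add: delta flip: scaleR_sum_left)
    also have "\<dots> = (\<Sum>c<rk E. K (\<beta> c) (s c) v' q)"
      by (simp add: if_distrib[of "\<lambda>x. x *\<^sub>R _"] cong: if_cong)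
    finally show ?case .
  qed
  then show ?thesis by (simp add: \<beta>_def s_def v'_def)
qed

text \<open>Near each point the contraction is one fixed finite sum of global sections, so it is
  smooth although the frames chosen at different points are unrelated.\<close>

lemma frame_contraction_section:
  assumes K: "trilinear K" and W: "open W" and loc: "local_section E W u" "local_section E W v"
  shows "local_section E W (frame_contraction E K nab u v)"
proof (rule local_section_eventually[OF W])
  fix p assume p: "p \<in> W"
  obtain V Y where V: "(V, Y) \<in> trivs E" "p \<in> V" by (rule triv_at)
  have o: "open (W \<inter> V)" "p \<in> W \<inter> V" using W p V triv_open by auto
  have Y: "local_frame E (W \<inter> V) Y"
    using local_frame_subset[OF local_frame_triv[OF V(1)] _ o(1)] by auto
  have loc': "local_section E (W \<inter> V) u" "local_section E (W \<inter> V) v"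
    using local_section_subset[OF loc(1) _ W o(1)] local_section_subset[OF loc(2) _ W o(1)] by auto
  have "(\<lambda>q. \<Sum>b<rk E. K (germ_ext_form E p (dual_coframe E Y b)) (germ_ext E p (restr2 E nab (Y b) u))
      (germ_ext E p v) q) \<in> sections E"
    using Y germ_ext_form(1)[OF Y o(2)] germ_ext(1)[OF o loc'(2)]
      germ_ext(1)[OF o restr2_nab_section[OF o(1) _ loc'(1)]]
    by (intro section_sum trilinear_section[OF K]) (auto simp: local_frame_def)
  then show "\<exists>t\<in>sections E. \<forall>\<^sub>F q in nhds p. frame_contraction E K nab u v q = t q"
    by (rule bexI[rotated]) (rule frame_contraction_eventually_eq[OF K Y o(2) loc'])
qed

end

section \<open>The structure equations\<close>

lemma ext_deriv_one_form:
  "ext_deriv E br \<Omega> [u, v] p = act E u (\<Omega> [v]) p - act E v (\<Omega> [u]) p - \<Omega> [br u v] p"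
  by (simp add: ext_deriv_def omit_def lessThan_Suc numeral_2_eq_2)

locale local_algebroid_connection =
  fixes E :: "('m::{t2_space,second_countable_topology}, 'b::real_inner, 'v::real_vector, 'z) local_algebroid_scheme"
    and P :: "('m \<Rightarrow> 'v) \<Rightarrow> ('m \<Rightarrow> 'v)"
    and nab :: "('m \<Rightarrow> 'v) \<Rightarrow> ('m \<Rightarrow> 'v) \<Rightarrow> ('m \<Rightarrow> 'v)"
  assumes local_algebroid: "local_pre_leibniz_algebroid E"
    and projector: "locality_projector E P"
    and connection: "linear_connection E nab"
    and admissible: "admissible E nab"
begin

sublocale connection E nab
  using local_algebroid connection
  by unfold_locales (simp_all add: local_pre_leibniz_algebroid_def pre_leibniz_algebroid_def)

section \<open>Locality of the bracket and smoothness of both modified brackets\<close>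

lemma pre_leibniz: "pre_leibniz_algebroid E"
  using local_algebroid unfolding local_pre_leibniz_algebroid_def by (rule conjunct1)

lemma bracket_bilinear: "R_bilinear E (bracket E)"
  using pre_leibniz unfolding pre_leibniz_algebroid_def by (elim conjE)

lemma bracket_Leibniz:
  assumes u: "u \<in> sections E"
  shows "Leibniz u (bracket E u)"
  unfolding Leibniz_def
proof
  show "R_linear E (bracket E u)" using bracket_bilinear u by (simp add: R_bilinear_def)
  have "\<forall>u\<in>sections E. \<forall>v\<in>sections E. \<forall>f\<in>smooth_functions E.
      bracket E u (\<lambda>p. f p *\<^sub>R v p) = (\<lambda>p. act E u f p *\<^sub>R v p + f p *\<^sub>R bracket E u v p)"
    using pre_leibniz unfolding pre_leibniz_algebroid_def by (elim conjE)
  from this[THEN bspec, OF u]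
  show "\<forall>v\<in>sections E. \<forall>f\<in>smooth_functions E.
      bracket E u (\<lambda>p. f p *\<^sub>R v p) = (\<lambda>p. act E u f p *\<^sub>R v p + f p *\<^sub>R bracket E u v p)" .
qed

text \<open>Locality in the first argument: admissibility exchanges the arguments up to contractions,
  which are local.\<close>

lemma bracket_local: "local_operator (bracket E)"
  unfolding local_operator_def
proof (intro allI ballI impI)
  fix p u u' v v'
  assume s: "u \<in> sections E" "u' \<in> sections E" "v \<in> sections E" "v' \<in> sections E"
    and eq: "\<forall>\<^sub>F q in nhds p. u q = u' q" "\<forall>\<^sub>F q in nhds p. v q = v' q"
  let ?c = "frame_contraction E (locality E) nab"
  have swap: "bracket E x v' p = ?c x v' p + ?c v' x p - bracket E v' x p" if "x \<in> sections E" for x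
  proof -
    have "(\<lambda>p. bracket E x v' p + bracket E v' x p) = (\<lambda>p. ?c x v' p + ?c v' x p)"
      by (rule admissible[unfolded admissible_def, THEN bspec, OF that, THEN bspec, OF s(4)])
    then have "bracket E x v' p + bracket E v' x p = ?c x v' p + ?c v' x p" by (rule fun_cong)
    then show ?thesis by (simp add: algebra_simps)
  qed
  have "bracket E u v p = bracket E u v' p"
    by (rule Leibniz_local[OF bracket_Leibniz[OF s(1)] s(3,4) eq(2)])
  also have "\<dots> = ?c u v' p + ?c v' u p - bracket E v' u p" by (rule swap[OF s(1)])
  also have "?c u v' p = ?c u' v' p" by (rule frame_contraction_germ_cong[OF eq(1)]) simp
  also have "?c v' u p = ?c v' u' p" by (rule frame_contraction_germ_cong[OF _ eq(1)]) simp
  also have "bracket E v' u p = bracket E v' u' p"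
    by (rule Leibniz_local[OF bracket_Leibniz[OF s(4)] s(1,2) eq(1)])
  also have "?c u' v' p + ?c v' u' p - bracket E v' u' p = bracket E u' v' p"
    by (rule swap[OF s(2), symmetric])
  finally show "bracket E u v p = bracket E u' v' p" .
qed

lemma locality_trilinear: "trilinear (locality E)"
  using local_algebroid unfolding local_pre_leibniz_algebroid_def trilinear_def by (elim conjE) (intro conjI)

lemma Cinf_linear_projector: "Cinf_linear E P"
  using projector unfolding locality_projector_def by (rule conjunct1)

lemma Cinf_linear_compose_projector:
  assumes F: "Cinf_linear E F"
  shows "Cinf_linear E (\<lambda>s. P (F s))"
  unfolding Cinf_linear_def
  by (intro conjI ballI)
    (simp_all add: Cinf_linearD[OF F] Cinf_linearD[OF Cinf_linear_projector])

lemma Cinf_linear_form_compose_projector: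
  assumes F: "Cinf_linear_form E F"
  shows "Cinf_linear_form E (\<lambda>s. P (F s))"
  unfolding Cinf_linear_form_def
  by (intro conjI ballI)
    (simp_all add: Cinf_linear_formD[OF F] Cinf_linearD[OF Cinf_linear_projector])

lemma projected_locality_trilinear: "trilinear (projected_locality E P)"
  using locality_trilinear
  by (simp add: trilinear_def projected_locality_def[abs_def]
      Cinf_linear_compose_projector Cinf_linear_form_compose_projector)

text \<open>Puts the modified bracket into the fibre, where the dual coframe is additive, and lets
  the projected one stand as the direction of a covariant derivative in the curvature.\<close>

lemma modified_bracket_section:
  assumes "open U" "local_section E U u" "local_section E U v"
  shows "local_section E U (modified_bracket E nab u v)"
    "local_section E U (projected_modified_bracket E P nab u v)"
  unfolding modified_bracket_def projected_modified_bracket_def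
  by (intro local_section_diff assms frame_contraction_section locality_trilinear
      projected_locality_trilinear restr2_local_section bracket_local bracket_bilinear)+

lemma torsion_structure_equation:
  assumes X: "local_frame E U X" and loc: "local_section E U u" "local_section E U v"
    and p: "p \<in> U" and a: "a < rk E"
  shows "torsion_form E nab X a [u, v] p =
    d_nab E nab (form1 (dual_coframe E X a)) [u, v] p
    + (\<Sum>b<rk E. wedge (connection_form E nab X a b) (form1 (dual_coframe E X b)) [u, v] p)"
proof -
  have U: "open U" and basis: "pointwise_basis E U X" using X by (auto simp: local_frame_def)
  note fib = restr2_nab_fibre[OF U p loc] restr2_nab_fibre[OF U p loc(2,1)]
    local_section_fibre[OF modified_bracket_section(1)[OF U loc] p]
  let ?e = "dual_coframe E X a p"
  have "torsion_form E nab X a [u, v] p =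
      ?e (restr2 E nab u v p) - ?e (restr2 E nab v u p) - ?e (modified_bracket E nab u v p)"
    using fib by (simp add: torsion_form_def torsion_def coframe_diff[OF basis p] subspace_diff[OF subspace_fibre])
  also have "\<dots> = d_nab E nab (form1 (dual_coframe E X a)) [u, v] p
      + (\<Sum>b<rk E. wedge (connection_form E nab X a b) (form1 (dual_coframe E X b)) [u, v] p)"
    \<comment> \<open>The derivative terms and the bracket term form the exterior derivative of the
      coframe element; the remaining sums are antisymmetric in u and v and form the wedge
      product.\<close>
    unfolding coframe_nab[OF X loc p a] coframe_nab[OF X loc(2,1) p a]
    by (simp add: d_nab_def ext_deriv_one_form form1_def[abs_def] wedge_def connection_form_def
        sum_subtractf mult.commute)
  finally show ?thesis .
qed

lemma curvature_structure_equation: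
  assumes X: "local_frame E U X" and loc: "local_section E U u" "local_section E U v"
    and p: "p \<in> U" and a: "a < rk E" and b: "b < rk E"
  shows "curvature_form E P nab X a b [u, v] p =
    d_hat_nab E P nab (connection_form E nab X a b) [u, v] p
    + (\<Sum>c<rk E. wedge (connection_form E nab X a c) (connection_form E nab X c b) [u, v] p)"
proof -
  have U: "open U" and basis: "pointwise_basis E U X" and Xb: "local_section E U (X b)"
    using X b by (auto simp: local_frame_def)
  note nabX = restr2_nab_section[OF U loc(1) Xb] restr2_nab_section[OF U loc(2) Xb]
  note fib = restr2_nab_fibre[OF U p loc(1) nabX(2)] restr2_nab_fibre[OF U p loc(2) nabX(1)]
    restr2_nab_fibre[OF U p modified_bracket_section(2)[OF U loc] Xb]
  let ?e = "dual_coframe E X a p"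
  have "curvature_form E P nab X a b [u, v] p =
      ?e (restr2 E nab u (restr2 E nab v (X b)) p) - ?e (restr2 E nab v (restr2 E nab u (X b)) p)
      - ?e (restr2 E nab (projected_modified_bracket E P nab u v) (X b) p)"
    using fib by (simp add: curvature_form_def curvature_def coframe_diff[OF basis p] subspace_diff[OF subspace_fibre])
  also have "\<dots> = d_hat_nab E P nab (connection_form E nab X a b) [u, v] p
      + (\<Sum>c<rk E. wedge (connection_form E nab X a c) (connection_form E nab X c b) [u, v] p)"
    \<comment> \<open>The components of \<nabla>_v X_b are by definition the functions
      \<open>\<omega>\<^sup>c\<^sub>b(v)\<close>, so the formula yields
      \<open>\<rho>(u)(\<omega>\<^sup>a\<^sub>b(v))\<close> and the products of connection forms.
      The last curvature term is \<open>\<omega>\<^sup>a\<^sub>b\<close> on the projected bracket,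
      as in the projected exterior derivative.\<close>
    unfolding coframe_nab[OF X loc(1) nabX(2) p a] coframe_nab[OF X loc(2) nabX(1) p a]
    by (simp add: d_hat_nab_def ext_deriv_one_form connection_form_def[abs_def] wedge_def
        sum_subtractf mult.commute)
  finally show ?thesis .
qed

end

theorem proposition3p10:
  fixes E :: "('m::{t2_space,second_countable_topology}, 'b::real_inner, 'v::real_vector) local_algebroid"
    and P :: "('m \<Rightarrow> 'v) \<Rightarrow> ('m \<Rightarrow> 'v)"
    and nab :: "('m \<Rightarrow> 'v) \<Rightarrow> ('m \<Rightarrow> 'v) \<Rightarrow> ('m \<Rightarrow> 'v)"
    and U :: "'m set"
    and X :: "nat \<Rightarrow> 'm \<Rightarrow> 'v"
  assumes "local_pre_leibniz_algebroid E"
    and "regular E"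
    and "locality_projector E P"
    and "linear_connection E nab"
    and "admissible E nab"
    and "local_frame E U X"
  shows "(\<forall>a<rk E. \<forall>u v. local_section E U u \<longrightarrow> local_section E U v \<longrightarrow> (\<forall>p\<in>U.
            torsion_form E nab X a [u, v] p =
            d_nab E nab (form1 (dual_coframe E X a)) [u, v] p
            + (\<Sum>b<rk E. wedge (connection_form E nab X a b) (form1 (dual_coframe E X b)) [u, v] p)))
       \<and> (\<forall>a<rk E. \<forall>b<rk E. \<forall>u v. local_section E U u \<longrightarrow> local_section E U v \<longrightarrow> (\<forall>p\<in>U.
            curvature_form E P nab X a b [u, v] p =
            d_hat_nab E P nab (connection_form E nab X a b) [u, v] p
            + (\<Sum>c<rk E. wedge (connection_form E nab X a c) (connection_form E nab X c b) [u, v] p)))"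
proof -
  interpret local_algebroid_connection E P nab
    by unfold_locales (fact assms)+
  show ?thesis
    using torsion_structure_equation[OF assms(6)] curvature_structure_equation[OF assms(6)] by blast
qed

end
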